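(* Let $\alpha>0$ be fixed. Let $\Omega\colon\mathbb{R}\to\mathbb{R}_+$ be a continual diagram and let $a<a_0<b_0<b$ be real numbers such that: (i) the restriction of $\Omega$ to $[a,b]$ is $(1-\delta)$-Lipschitz for some constant $\delta>0$; (ii) the restriction of the transition measure $\mu_\Omega$ to $[a,b]$ is absolutely continuous with a density bounded from above by some constant. Let $(\omega_n)_{n\ge1}$ be a sequence of random continual diagrams such that \[ n^{\alpha}\log n\cdot d(\Omega,\omega_n)\xrightarrow[n\to\infty]{P}0 .\] Then \[ n^{\alpha}\sup_{z\in[a_0,b_0]}\big|K_{\omega_n}(z)-K_{\Omega}(z)\big|\xrightarrow[n\to\infty]{P}0.\]
   Context: A continual diagram is a function $\omega\colon\mathbb{R}\to\mathbb{R}_+$ such that $|\omega(z_1)-\omega(z_2)|\le|z_1-z_2|$ for all $z_1,z_2\in\mathbb{R}$, and $\omega(z)=|z|$ for all sufficiently large $|z|$. Transition measure: for a continual diagram $\omega$, its Cauchy transform $\mathbf{G}_\omega$ is defined for $z\in\mathbb{C}\setminus\mathbb{R}$ by \[\log\big[z\,\mathbf{G}_\omega(z)\big]=-\int_{-\infty}^{\infty}\frac{1}{z-w}\left(\frac{\omega(w)-|w|}{2}\right)'\,dw,\] and the transition measure $\mu_\omega$ is the unique (compactly supported) probability measure on $\mathbb{R}$ with $\mathbf{G}_\omega(z)=\int\frac{1}{z-x}\,d\mu_\omega(x)$. The cumulative function is $K_\omega(z)=\mu_\omega((-\infty,z])$. Metric $d$: for $x,y\ge0$ write $(x,y)\in\omega$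 if $\omega(x-y)=x+y$. For $x\ge0$ let $\Pi^\omega_Y(x)=\{y\ge 0:(x,y)\in\omega\}$ and for $y\ge0$ let $\Pi^\omega_X(y)=\{x\ge0:(x,y)\in\omega\}$. Define $d_Y(\omega_1,\omega_2)=\sup_{x\ge0}d_H(\Pi_Y^{\omega_1}(x),\Pi_Y^{\omega_2}(x))$, $d_X(\omega_1,\omega_2)=\sup_{y\ge0}d_H(\Pi_X^{\omega_1}(y),\Pi_X^{\omega_2}(y))$ with $d_H$ the Hausdorff distance, and $d=\max(d_X,d_Y)$. $\xrightarrow{P}$ denotes convergence in probability. *)

theory Defs
  imports "HOL-Probability.Probability"
begin

definition continual_diagram :: "(real \<Rightarrow> real) \<Rightarrow> bool" where
  "continual_diagram \<omega> \<longleftrightarrow>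
     (\<forall>z. 0 \<le> \<omega> z) \<and>
     (\<forall>z1 z2. \<bar>\<omega> z1 - \<omega> z2\<bar> \<le> \<bar>z1 - z2\<bar>) \<and>
     (\<exists>C. \<forall>z. C \<le> \<bar>z\<bar> \<longrightarrow> \<omega> z = \<bar>z\<bar>)"

definition diag_sigma :: "(real \<Rightarrow> real) \<Rightarrow> real \<Rightarrow> real" where
  "diag_sigma \<omega> w = (\<omega> w - \<bar>w\<bar>) / 2"

definition cauchy_transform :: "real measure \<Rightarrow> complex \<Rightarrow> complex" where
  "cauchy_transform \<mu> z = (\<integral>x. 1 / (z - complex_of_real x) \<partial>\<mu>)"

text \<open>mu is a transition measure of omega: a compactly supported Borel probability
  measure whose Cauchy transform G satisfies log[z G(z)] = - int 1/(z-w) sigma'(w) dw,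
  i.e. z G(z) = exp(- int 1/(z-w) sigma'(w) dw), for all non-real z.\<close>
definition is_transition_measure :: "(real \<Rightarrow> real) \<Rightarrow> real measure \<Rightarrow> bool" where
  "is_transition_measure \<omega> \<mu> \<longleftrightarrow>
     prob_space \<mu> \<and> sets \<mu> = sets borel \<and>
     (\<exists>C. emeasure \<mu> {x. C < \<bar>x\<bar>} = 0) \<and>
     (\<forall>z::complex. Im z \<noteq> 0 \<longrightarrow>
        z * cauchy_transform \<mu> z =
        exp (- (\<integral>w. complex_of_real (deriv (diag_sigma \<omega>) w) / (z - complex_of_real w) \<partial>lebesgue)))"

definition transition_measure :: "(real \<Rightarrow> real) \<Rightarrow> real measure" where
  "transition_measure \<omega> = (THE \<mu>. is_transition_measure \<omega> \<mu>)"

definition cumulative :: "(real \<Rightarrow> real) \<Rightarrow> real \<Rightarrow> real" where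
  "cumulative \<omega> z = measure (transition_measure \<omega>) {..z}"

definition PiY :: "(real \<Rightarrow> real) \<Rightarrow> real \<Rightarrow> real set" where
  "PiY \<omega> x = {y. 0 \<le> y \<and> \<omega> (x - y) = x + y}"

definition PiX :: "(real \<Rightarrow> real) \<Rightarrow> real \<Rightarrow> real set" where
  "PiX \<omega> y = {x. 0 \<le> x \<and> \<omega> (x - y) = x + y}"

definition hausdorff_dist :: "real set \<Rightarrow> real set \<Rightarrow> ennreal" where
  "hausdorff_dist A B =
     max (SUP a\<in>A. INF b\<in>B. ennreal \<bar>a - b\<bar>) (SUP b\<in>B. INF a\<in>A. ennreal \<bar>a - b\<bar>)"

definition dY :: "(real \<Rightarrow> real) \<Rightarrow> (real \<Rightarrow> real) \<Rightarrow> ennreal" where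
  "dY \<omega>1 \<omega>2 = (SUP x\<in>{0..}. hausdorff_dist (PiY \<omega>1 x) (PiY \<omega>2 x))"

definition dX :: "(real \<Rightarrow> real) \<Rightarrow> (real \<Rightarrow> real) \<Rightarrow> ennreal" where
  "dX \<omega>1 \<omega>2 = (SUP y\<in>{0..}. hausdorff_dist (PiX \<omega>1 y) (PiX \<omega>2 y))"

definition diag_dist :: "(real \<Rightarrow> real) \<Rightarrow> (real \<Rightarrow> real) \<Rightarrow> ennreal" where
  "diag_dist \<omega>1 \<omega>2 = max (dX \<omega>1 \<omega>2) (dY \<omega>1 \<omega>2)"

text \<open>Outer probability; coincides with the probability for measurable sets.\<close>
definition outer_prob :: "'a measure \<Rightarrow> 'a set \<Rightarrow> real" where
  "outer_prob M S = Inf (measure M ` {A \<in> sets M. S \<subseteq> A})"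

definition conv_prob_zero :: "'a measure \<Rightarrow> (nat \<Rightarrow> 'a \<Rightarrow> 'b::{linorder,zero}) \<Rightarrow> bool" where
  "conv_prob_zero M X \<longleftrightarrow>
     (\<forall>\<epsilon>>0. ((\<lambda>n. outer_prob M {s \<in> space M. \<epsilon> < X n s}) \<longlongrightarrow> 0) sequentially)"

end

theory Submission
  imports Defs "HOL-Real_Asymp.Real_Asymp"
begin

text \<open>
  The metric \<open>d\<close> dominates the sup norm up to a factor \<open>2\<close>, and only the sup norm is used.
  Everything happens on the vertical line above a point \<open>s \<in> [a\<^sub>0, b\<^sub>0]\<close>.  By Fubini,
  \<open>\<integral> arctan ((s - t) / h) d\<mu>(t) = \<integral>\<^sub>h\<^sup>\<infinity> Re G(s + iv) dv\<close>, so a smoothing of the cumulative function at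
  scale \<open>h\<close> is read off the Cauchy transform, and the smoothing error is at most
  \<open>h \<integral>\<^sub>h\<^sup>\<infinity> - Im G(s + iv) / v dv\<close>.  Hypothesis (i) keeps the argument of \<open>G\<^sub>\<Omega>\<close> away from \<open>0\<close> and \<open>-\<pi>\<close>
  and hypothesis (ii) bounds \<open>Im G\<^sub>\<Omega>\<close>, so \<open>|G\<^sub>\<Omega>(s + iv)| \<le> M / (1 + v)\<close>.  If \<open>|\<Omega> - \<omega>| \<le> 2e\<close>, then
  integration by parts gives \<open>G\<^sub>\<omega> = G\<^sub>\<Omega> exp \<Delta>\<close> with \<open>|\<Delta>| \<le> \<pi> e / v\<close>; with \<open>h = e\<close> all errors are
  \<open>O(e ln (1 + 1/e))\<close>, which is where the logarithm in the hypothesis comes from.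

  That every continual diagram has a transition measure is proved by discretisation:
  \<open>G(z) = exp (\<integral>\<^bsub>[-C,C]\<^esub> \<rho>(w) / (z - w) dw) / (z + C)\<close> with \<open>\<rho> = (1 - \<omega>') / 2 \<in> [0, 1]\<close> is a limit of
  interlacing products, which are Cauchy transforms of finitely supported probability measures.
\<close>

section \<open>Lipschitz functions on the line\<close>

text \<open>The diagrams \<open>\<omega> n s\<close> are close to \<open>\<Omega>\<close> only in
  sup norm, so their transition measures have no regularity of their own. This is why the comparison
  is multiplicative: \<open>G\<^sub>\<omega> = G\<^sub>\<Omega> exp \<Delta>\<close> transfers the
  bound on \<open>|G\<^sub>\<Omega>|\<close> to \<open>\<omega>\<close> at the cost of a factor
  \<open>exp pi\<close> as long as \<open>v \<ge> e\<close>, where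
  \<open>|\<Delta>| \<le> pi\<close>. The difference
  \<open>G\<^sub>\<Omega> (exp \<Delta> - 1)\<close> involves the modulus of
  \<open>G\<^sub>\<Omega>\<close>, whereas a density bound controls only its imaginary part;
  hypothesis (i) supplies the passage from one to the other. Two features of the definitions also
  shape the proof. \<open>transition_measure\<close> is a definite description, so existence and
  uniqueness must precede any statement about it. And \<open>deriv\<close> is a pointwise
  derivative, meaningful for a Lipschitz function only almost everywhere; hence the opening section
  on differentiability and the fundamental theorem of calculus.\<close>

lemma emeasure_interval_measure_ball:
  fixes f :: "real \<Rightarrow> real"
  assumes "mono f" "continuous_on UNIV f" "0 < r"
  shows "emeasure (interval_measure f) (ball c r) = ennreal (f (c + r) - f (c - r))"
proof -
  have m: "\<And>x y. x \<le> y \<Longrightarrow> f x \<le> f y"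
    using assms(1) by (simp add: mono_def)
  have Icc: "emeasure (interval_measure f) {a..b} = ennreal (f b - f a)" if "a \<le> b" for a b
    using emeasure_interval_measure_Icc[OF that m assms(2)] by simp
  have "{c - r..c + r} = ball c r \<union> ({c - r} \<union> {c + r})"
    using assms(3) by (auto simp: ball_eq_greaterThanLessThan)
  then have "emeasure (interval_measure f) {c - r..c + r}
      = emeasure (interval_measure f) (ball c r \<union> ({c - r} \<union> {c + r}))"
    by (rule arg_cong)
  also have "\<dots> = emeasure (interval_measure f) (ball c r)"
  proof (rule emeasure_Un_null_set)
    have "{x} \<in> null_sets (interval_measure f)" for x
      using Icc[of x x] by (simp add: null_sets_def)
    then show "{c - r} \<union> {c + r} \<in> null_sets (interval_measure f)"
      by blast
  qed simp
  finally show ?thesis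
    using Icc[of "c - r" "c + r"] assms(3) by simp
qed

text \<open>A Vitali family allows two measures to be compared interval by interval; countable
  additivity carries the comparison to the union. It is used between scaled Lebesgue measure and the
  Stieltjes measure of \<open>f\<close>, in both directions.\<close>

lemma emeasure_disjoint_balls_mono:
  fixes N P :: "real measure" and C :: "(real \<times> real) set"
  assumes "sets N = sets borel" "sets P = sets borel" "countable C"
    and "pairwise (\<lambda>i j. disjnt (ball (fst i) (snd i)) (ball (fst j) (snd j))) C"
    and le: "\<And>c r. (c, r) \<in> C \<Longrightarrow> emeasure N (ball c r) \<le> emeasure P (ball c r)"
  shows "emeasure N (\<Union>i\<in>C. ball (fst i) (snd i)) \<le> emeasure P (\<Union>i\<in>C. ball (fst i) (snd i))"
proof -
  have disj: "disjoint_family_on (\<lambda>i. ball (fst i) (snd i)) C"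
    using assms(4) by (auto simp: disjoint_family_on_def pairwise_def disjnt_def)
  have "emeasure N (\<Union>i\<in>C. ball (fst i) (snd i)) =
      (\<integral>\<^sup>+i. emeasure N (ball (fst i) (snd i)) \<partial>count_space C)"
    using assms(1,3) disj by (intro emeasure_UN_countable) auto
  also have "\<dots> \<le> (\<integral>\<^sup>+i. emeasure P (ball (fst i) (snd i)) \<partial>count_space C)"
    using le by (intro nn_integral_mono) auto
  also have "\<dots> = emeasure P (\<Union>i\<in>C. ball (fst i) (snd i))"
    using assms(2,3) disj by (intro emeasure_UN_countable[symmetric]) auto
  finally show ?thesis .
qed

text \<open>The point is interior to the interval and not an endpoint, which makes the set a \<open>G\<^sub>\<delta>\<close>.\<close>

definition small_slopes :: "(real \<Rightarrow> real \<Rightarrow> bool) \<Rightarrow> real set" where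
  "small_slopes P = {x. \<forall>d>0. \<exists>y w. y < x \<and> x < w \<and> w - y < d \<and> P y w}"

lemma small_slopes_borel: "small_slopes P \<in> sets borel"
proof -
  have "small_slopes P = (\<Inter>n. \<Union>(y, w)\<in>{(y, w). w - y < 1 / real (Suc n) \<and> P y w}. {y<..<w})"
  proof (intro equalityI subsetI)
    fix x assume x: "x \<in> small_slopes P"
    show "x \<in> (\<Inter>n. \<Union>(y, w)\<in>{(y, w). w - y < 1 / real (Suc n) \<and> P y w}. {y<..<w})"
    proof
      fix n :: nat
      have "(0::real) < 1 / real (Suc n)" by simp
      then obtain y w where "y < x" "x < w" "w - y < 1 / real (Suc n)" "P y w"
        using x unfolding small_slopes_def by blast
      then show "x \<in> (\<Union>(y, w)\<in>{(y, w). w - y < 1 / real (Suc n) \<and> P y w}. {y<..<w})"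
        by auto
    qed
  next
    fix x assume x: "x \<in> (\<Inter>n. \<Union>(y, w)\<in>{(y, w). w - y < 1 / real (Suc n) \<and> P y w}. {y<..<w})"
    show "x \<in> small_slopes P"
      unfolding small_slopes_def
    proof (intro CollectI allI impI)
      fix d :: real assume "0 < d"
      then obtain n where n: "1 / real (Suc n) < d"
        using nat_approx_posE by blast
      obtain y w where "w - y < 1 / real (Suc n)" "P y w" "y < x" "x < w"
        using x by fastforce
      with n show "\<exists>y w. y < x \<and> x < w \<and> w - y < d \<and> P y w"
        by (intro exI[of _ y] exI[of _ w]) auto
    qed
  qed
  also have "\<dots> \<in> sets borel"
    by (intro sets.countable_INT'' borel_open open_UN ballI) auto
  finally show ?thesis .
qed

text \<open>The qualifying intervals around a point shrink to it, so they cover \<open>S\<close>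
  finely in the sense of Vitali. An interval from \<open>y\<close> to \<open>w\<close> enters as the
  ball with centre \<open>(y + w) / 2\<close> and radius \<open>(w - y) / 2\<close>.\<close>

lemma small_slopes_Vitali:
  assumes "S \<subseteq> small_slopes P" "S \<subseteq> U" "open U"
  obtains C :: "(real \<times> real) set" where "countable C"
    "pairwise (\<lambda>i j. disjnt (ball (fst i) (snd i)) (ball (fst j) (snd j))) C"
    "negligible (S - (\<Union>i\<in>C. ball (fst i) (snd i)))"
    "\<And>c r. (c, r) \<in> C \<Longrightarrow> 0 < r \<and> ball c r \<subseteq> U \<and> P (c - r) (c + r)"
proof -
  define K where "K = {(c, r). 0 < r \<and> ball c r \<subseteq> U \<and> P (c - r) (c + r)}"
  have K: "\<exists>i. i \<in> K \<and> x \<in> ball (fst i) (snd i) \<and> snd i < d" if xd: "x \<in> S" "0 < d" for x d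
  proof -
    obtain e where e: "0 < e" "ball x e \<subseteq> U"
      using assms(2,3) xd(1) by (meson openE subsetD)
    have "x \<in> small_slopes P" "0 < min d e"
      using assms(1) xd e by auto
    then obtain y w where yw: "y < x" "x < w" "w - y < min d e" "P y w"
      unfolding small_slopes_def by blast
    have eq: "(y + w) / 2 - (w - y) / 2 = y" "(y + w) / 2 + (w - y) / 2 = w"
      by (simp_all add: field_simps)
    have "{y<..<w} \<subseteq> ball x e"
      using yw by (auto simp: dist_real_def)
    then have "((y + w) / 2, (w - y) / 2) \<in> K"
      using yw e unfolding K_def by (auto simp: ball_eq_greaterThanLessThan eq)
    moreover have "x \<in> ball ((y + w) / 2) ((w - y) / 2)"
      using yw by (simp add: ball_eq_greaterThanLessThan eq)
    ultimately show ?thesis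
      using yw by (intro exI[of _ "((y + w) / 2, (w - y) / 2)"]) auto
  qed
  obtain C where "countable C" "C \<subseteq> K"
    "pairwise (\<lambda>i j. disjnt (ball (fst i) (snd i)) (ball (fst j) (snd j))) C"
    "negligible (S - (\<Union>i\<in>C. ball (fst i) (snd i)))"
    using Vitali_covering_theorem_balls[OF K] .
  moreover from \<open>C \<subseteq> K\<close> have "0 < r \<and> ball c r \<subseteq> U \<and> P (c - r) (c + r)" if "(c, r) \<in> C" for c r
    using that unfolding K_def by auto
  ultimately show thesis
    by (intro that)
qed

text \<open>Cover the set by disjoint intervals of slope below \<open>p\<close>, and then its part in these intervals by
  disjoint subintervals of slope above \<open>q\<close>; by monotonicity the latter increase \<open>f\<close> by no more than
  the former.\<close>

lemma mono_slopes_negligible: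
  fixes f :: "real \<Rightarrow> real"
  assumes f: "mono f" "continuous_on UNIV f" and pq: "0 \<le> p" "p < q"
  shows "negligible (small_slopes (\<lambda>y w. f w - f y < p * (w - y)) \<inter>
                     small_slopes (\<lambda>y w. q * (w - y) < f w - f y) \<inter> {a<..<b})"
    (is "negligible ?E")
proof -
  define \<nu> where "\<nu> = interval_measure f"
  have sets_\<nu>: "sets \<nu> = sets borel"
    unfolding \<nu>_def by simp
  define E where "E = ?E"
  have E[measurable]: "E \<in> sets borel"
    unfolding E_def using small_slopes_borel by simp
  have E_lo: "E \<subseteq> small_slopes (\<lambda>y w. f w - f y < p * (w - y))"
    and E_hi: "E \<subseteq> small_slopes (\<lambda>y w. q * (w - y) < f w - f y)"
    unfolding E_def by auto
  have "emeasure lborel E \<le> emeasure lborel {a<..<b}"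
    unfolding E_def by (intro emeasure_mono) auto
  also have "\<dots> < \<infinity>"
    by (cases "a \<le> b") auto
  finally have finE: "emeasure lborel E < \<infinity>" .
  define m where "m = measure lborel E"
  have mE: "emeasure lborel E = ennreal m"
    using finE unfolding m_def by (intro emeasure_eq_ennreal_measure) simp
  have m0: "0 \<le> m" unfolding m_def by simp
  \<comment> \<open>With |.| for Lebesgue measure, the chain is q |E| \<le> \<nu>(B) \<le> \<nu>(A)
    \<le> p |A| \<le> p (m + e). The open set \<open>U\<close> exceeds \<open>E\<close> by less than
    \<open>e\<close>, \<open>A\<close> is the union of the flat intervals in \<open>U\<close>, and
    \<open>B\<close> that of the steep ones inside \<open>A\<close>.\<close>
  have bound: "q * m \<le> p * (m + e)" if e: "0 < e" for e
  proof -
    obtain U where U: "open U" "E \<subseteq> U" "emeasure lborel (U - E) < ennreal e"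
      using outer_regular_lborel[OF E e] .
    have "emeasure lborel U \<le> emeasure lborel (E \<union> (U - E))"
      using U by (intro emeasure_mono) (auto intro!: sets.Un sets.Diff borel_open)
    also have "\<dots> \<le> emeasure lborel E + emeasure lborel (U - E)"
      using U by (intro emeasure_subadditive) auto
    also have "\<dots> \<le> ennreal (m + e)"
      using U(3) mE m0 e by (simp add: less_imp_le add_mono)
    finally have mU: "emeasure lborel U \<le> ennreal (m + e)" .
    obtain C where C: "countable C"
      "pairwise (\<lambda>i j. disjnt (ball (fst i) (snd i)) (ball (fst j) (snd j))) C"
      "negligible (E - (\<Union>i\<in>C. ball (fst i) (snd i)))"
      "\<And>c r. (c, r) \<in> C \<Longrightarrow> 0 < r \<and> ball c r \<subseteq> U \<and> f (c + r) - f (c - r) < p * ((c + r) - (c - r))"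
      by (rule small_slopes_Vitali[OF E_lo U(2,1)]) blast
    define A where "A = (\<Union>i\<in>C. ball (fst i) (snd i))"
    have A: "open A" "A \<subseteq> U"
      unfolding A_def using C(4) by (blast, fastforce)
    have ball_len: "emeasure lborel (ball c r) = ennreal (2 * r)" if "0 < r" for c r :: real
      using that by (simp add: ball_eq_greaterThanLessThan emeasure_lborel_Ioo)
    have "emeasure \<nu> A \<le> emeasure (scale_measure (ennreal p) lborel) A"
      unfolding A_def
    proof (rule emeasure_disjoint_balls_mono[OF sets_\<nu> _ C(1,2)])
      fix c r assume "(c, r) \<in> C"
      from C(4)[OF this] have "0 < r" "f (c + r) - f (c - r) \<le> p * (2 * r)"
        by auto
      then show "emeasure \<nu> (ball c r) \<le> emeasure (scale_measure (ennreal p) lborel) (ball c r)"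
        using pq by (simp add: \<nu>_def emeasure_interval_measure_ball[OF f] ball_len ennreal_mult[symmetric])
    qed simp
    also have "\<dots> \<le> ennreal p * ennreal (m + e)"
      using mU A U by (auto intro!: mult_left_mono order_trans[OF emeasure_mono mU])
    finally have \<nu>A: "emeasure \<nu> A \<le> ennreal (p * (m + e))"
      using pq m0 e by (simp add: ennreal_mult)
    obtain D where D: "countable D"
      "pairwise (\<lambda>i j. disjnt (ball (fst i) (snd i)) (ball (fst j) (snd j))) D"
      "negligible (E \<inter> A - (\<Union>i\<in>D. ball (fst i) (snd i)))"
      "\<And>c r. (c, r) \<in> D \<Longrightarrow> 0 < r \<and> ball c r \<subseteq> A \<and> q * ((c + r) - (c - r)) < f (c + r) - f (c - r)"
      by (rule small_slopes_Vitali[of "E \<inter> A" "\<lambda>y w. q * (w - y) < f w - f y" A])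
        (use E_hi A in blast)+
    define B where "B = (\<Union>i\<in>D. ball (fst i) (snd i))"
    have B: "open B" "B \<subseteq> A"
      unfolding B_def using D(4) by (blast, fastforce)
    \<comment> \<open>Being Borel, the part of \<open>E\<close> missed by the two families is null
      already for \<open>lborel\<close>, not only for its completion.\<close>
    have neg: "(E - A) \<union> (E \<inter> A - B) \<in> null_sets lborel"
    proof -
      have "(E - A) \<union> (E \<inter> A - B) \<in> null_sets lebesgue"
        using C(3) D(3) unfolding A_def[symmetric] B_def[symmetric] negligible_iff_null_sets by blast
      moreover have "(E - A) \<union> (E \<inter> A - B) \<in> sets borel"
        using A(1) B(1) by (intro sets.Un sets.Diff sets.Int E borel_open)
      ultimately show ?thesis
        by (auto simp: null_sets_def)
    qed
    have "ennreal q * emeasure lborel E \<le> ennreal q * emeasure lborel (B \<union> ((E - A) \<union> (E \<inter> A - B)))"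
      using A(1) B(1) by (intro mult_left_mono emeasure_mono sets.Un sets.Diff sets.Int) auto
    also have "\<dots> = emeasure (scale_measure (ennreal q) lborel) B"
      using emeasure_Un_null_set[OF _ neg, of B] B by simp
    also have "\<dots> \<le> emeasure \<nu> B"
      unfolding B_def
    proof (rule emeasure_disjoint_balls_mono[OF _ sets_\<nu> D(1,2)])
      fix c r assume "(c, r) \<in> D"
      from D(4)[OF this] have "0 < r" "q * (2 * r) \<le> f (c + r) - f (c - r)"
        by auto
      then show "emeasure (scale_measure (ennreal q) lborel) (ball c r) \<le> emeasure \<nu> (ball c r)"
        using pq by (simp add: ennreal_leI \<nu>_def emeasure_interval_measure_ball[OF f] ball_len ennreal_mult[symmetric])
    qed simp
    also have "\<dots> \<le> emeasure \<nu> A"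
      using A B by (intro emeasure_mono) (auto simp: sets_\<nu>)
    also note \<nu>A
    finally show ?thesis
      using pq m0 e unfolding mE by (simp add: ennreal_mult[symmetric])
  qed
  have "q * m \<le> p * m"
  proof (rule field_le_epsilon)
    fix e :: real assume e: "0 < e"
    have "q * m \<le> p * (m + e / (p + 1))"
      using bound[of "e / (p + 1)"] e pq by simp
    also have "\<dots> \<le> p * m + e"
      using e pq by (simp add: field_simps)
    finally show "q * m \<le> p * m + e" .
  qed
  then have "m = 0"
    using pq m0 by (metis mult_le_cancel_right not_le order_antisym_conv)
  then have "E \<in> null_sets lborel"
    using mE by (auto simp: null_sets_def)
  then show ?thesis
    unfolding negligible_iff_null_sets E_def by (rule null_sets_completionI)
qed


text \<open>\<open>small_slopes\<close> only sees intervals with \<open>x\<close> strictly inside,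
  while a derivative at \<open>x\<close> needs intervals ending at \<open>x\<close>. Pushing both
  ends outwards by 1 / (n + 1) and using continuity bridges the gap.\<close>

lemma slope_bound_closed:
  fixes g :: "real \<Rightarrow> real"
  assumes g: "continuous_on UNIV g"
    and bd: "\<And>y w. y < x \<Longrightarrow> x < w \<Longrightarrow> w - y < d \<Longrightarrow> g w - g y \<le> c * (w - y)"
    and yw: "y \<le> x" "x \<le> w" "w - y < d"
  shows "g w - g y \<le> c * (w - y)"
proof -
  have z: "(\<lambda>n. 1 / real (Suc n)) \<longlonglongrightarrow> 0"
    by (rule LIMSEQ_Suc[OF lim_1_over_n])
  have Y: "(\<lambda>n. y - 1 / real (Suc n)) \<longlonglongrightarrow> y"
    using tendsto_diff[OF tendsto_const z, of y] by simp
  have W: "(\<lambda>n. w + 1 / real (Suc n)) \<longlonglongrightarrow> w"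
    using tendsto_add[OF tendsto_const z, of w] by simp
  have gY: "(\<lambda>n. g (y - 1 / real (Suc n))) \<longlonglongrightarrow> g y"
    and gW: "(\<lambda>n. g (w + 1 / real (Suc n))) \<longlonglongrightarrow> g w"
    using continuous_on_tendsto_compose[OF g Y] continuous_on_tendsto_compose[OF g W] by simp_all
  have "\<forall>\<^sub>F n in sequentially. (w + 1 / real (Suc n)) - (y - 1 / real (Suc n)) < d"
    using order_tendstoD(2)[OF tendsto_diff[OF W Y] yw(3)] .
  then have ev: "\<forall>\<^sub>F n in sequentially. g (w + 1 / real (Suc n)) - g (y - 1 / real (Suc n))
      \<le> c * ((w + 1 / real (Suc n)) - (y - 1 / real (Suc n)))"
  proof eventually_elim
    case (elim n)
    have "0 < 1 / real (Suc n)" by simp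
    with yw elim show ?case by (intro bd) linarith+
  qed
  show ?thesis
    by (rule tendsto_le[OF sequentially_bot _ _ ev])
      (intro tendsto_intros gW gY W Y)+
qed

text \<open>Adding \<open>L * x\<close> makes the function increasing with slopes in [0, 2 L]. Off a
  countable union of negligible sets, indexed by rationals p < q, a point cannot have arbitrarily
  short intervals around it of slope below p and others of slope above q, so upper and lower limits
  of the slopes agree.\<close>

lemma lipschitz_AE_differentiable:
  fixes f :: "real \<Rightarrow> real"
  assumes lip: "\<And>x y. \<bar>f x - f y\<bar> \<le> L * \<bar>x - y\<bar>"
  shows "AE x in lebesgue. f differentiable at x"
proof -
  define g where "g x = f x + L * x" for x
  have L0: "0 \<le> L"
    using lip[of 1 0] by simp
  have mono: "mono g"
  proof (rule monoI)
    fix x y :: real assume "x \<le> y"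
    then show "g x \<le> g y"
      using lip[of x y] by (simp add: g_def algebra_simps abs_le_iff)
  qed
  have cont: "continuous_on UNIV g"
  proof -
    have "L-lipschitz_on UNIV f"
      using lip L0 by (auto simp: lipschitz_on_def dist_real_def)
    then have "continuous_on UNIV f"
      by (rule lipschitz_on_continuous_on)
    then show ?thesis
      unfolding g_def by (intro continuous_intros)
  qed
  have up: "g w - g y \<le> 2 * L * (w - y)" if "y \<le> w" for y w
    using lip[of w y] that by (simp add: g_def algebra_simps abs_le_iff)
  define lo where "lo p = small_slopes (\<lambda>y w. g w - g y < p * (w - y))" for p
  define hi where "hi q = small_slopes (\<lambda>y w. q * (w - y) < g w - g y)" for q
  define N where "N = (\<Union>p\<in>{p\<in>\<rat>. 0 \<le> p}. \<Union>q\<in>{q\<in>\<rat>. p < q}. \<Union>n::nat. lo p \<inter> hi q \<inter> {- real n<..<real n})"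
  have cp: "countable {p\<in>\<rat>. 0 \<le> (p::real)}" and cq: "\<And>p::real. countable {q\<in>\<rat>. p < q}"
    by (auto intro: countable_subset[OF _ countable_rat])
  have "N \<in> null_sets lebesgue"
    unfolding N_def using cp cq mono_slopes_negligible[OF mono cont]
    by (intro null_sets_UN' null_sets_UN) (auto simp: lo_def hi_def negligible_iff_null_sets[symmetric])
  moreover have "f differentiable at x" if "x \<notin> N" for x
  proof -
    obtain n :: nat where n: "\<bar>x\<bar> < real n"
      using reals_Archimedean2 by blast
    have sep: False if "p \<in> \<rat>" "q \<in> \<rat>" "0 \<le> p" "p < q" "x \<in> lo p" "x \<in> hi q" for p q
      using \<open>x \<notin> N\<close> that n unfolding N_def by (auto simp: abs_less_iff)
    \<comment> \<open>\<open>D\<close> is the upper limit of the slopes over intervals shrinking to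
      \<open>x\<close>. Inserting 0 makes the set nonempty without changing this, since no slope of
      the increasing \<open>g\<close> is negative.\<close>
    define A where "A = insert 0 {q. x \<in> hi q}"
    have A_le: "q \<le> 2 * L" if "q \<in> A" for q
    proof (rule ccontr)
      assume "\<not> ?thesis"
      with that L0 have "x \<in> hi q" "2 * L < q"
        unfolding A_def by auto
      then obtain y w where yw: "y < x" "x < w" "q * (w - y) < g w - g y"
        unfolding hi_def small_slopes_def by (auto dest: spec[of _ 1])
      have "2 * L * (w - y) \<le> q * (w - y)"
        using yw \<open>2 * L < q\<close> by (intro mult_right_mono) auto
      then show False
        using up[of y w] yw by linarith
    qed
    have bdd: "bdd_above A"
      using A_le by (rule bdd_aboveI)
    define D where "D = Sup A"
    have hi_ev: "\<exists>d>0. \<forall>y w. y \<le> x \<longrightarrow> x \<le> w \<longrightarrow> w - y < d \<longrightarrow> g w - g y \<le> (D + e) * (w - y)"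
      if e: "0 < e" for e
    proof -
      have "D + e \<notin> A"
        using cSup_upper[OF _ bdd, of "D + e"] e unfolding D_def by auto
      then have "x \<notin> hi (D + e)"
        unfolding A_def by auto
      then obtain d where d: "0 < d" "\<And>y w. y < x \<Longrightarrow> x < w \<Longrightarrow> w - y < d \<Longrightarrow> g w - g y \<le> (D + e) * (w - y)"
        unfolding hi_def small_slopes_def mem_Collect_eq by (meson not_less)
      then show ?thesis
        using slope_bound_closed[OF cont d(2)] by blast
    qed
    have lo_ev: "\<exists>d>0. \<forall>y w. y \<le> x \<longrightarrow> x \<le> w \<longrightarrow> w - y < d \<longrightarrow> (D - e) * (w - y) \<le> g w - g y"
      if e: "0 < e" for e
    \<comment> \<open>The set \<open>N\<close> only separates slopes p \<ge> 0; below 0 the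
      monotonicity of \<open>g\<close> gives the bound.\<close>
    proof (cases "D - e < 0")
      case True
      have "(D - e) * (w - y) \<le> g w - g y" if "y \<le> x" "x \<le> w" for y w
      proof -
        have "(D - e) * (w - y) \<le> 0"
          using True that by (intro mult_nonpos_nonneg) auto
        also have "0 \<le> g w - g y"
          using monoD[OF mono, of y w] that by simp
        finally show ?thesis .
      qed
      then show ?thesis
        by (intro exI[of _ 1]) auto
    next
      case False
      have "D - e < Sup A"
        using e unfolding D_def by simp
      then obtain q where "q \<in> A" "D - e < q"
        using less_cSup_iff[OF _ bdd] unfolding A_def by blast
      with False have q: "x \<in> hi q" "D - e < q"
        unfolding A_def by auto
      \<comment> \<open>\<open>N\<close> is a union over rational pairs, so a rational pair
        \<open>p < q'\<close> is squeezed between \<open>D - e\<close> and the real slope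
        \<open>q\<close>. Lowering \<open>q\<close> to \<open>q'\<close> only enlarges
        \<open>hi\<close>.\<close>
      obtain p where p: "p \<in> \<rat>" "D - e < p" "p < q"
        using Rats_dense_in_real[OF q(2)] by auto
      obtain q' where q': "q' \<in> \<rat>" "p < q'" "q' < q"
        using Rats_dense_in_real[OF p(3)] by auto
      have "x \<in> hi q'"
      proof -
        have "q' * (w - y) < g w - g y" if "y < w" "q * (w - y) < g w - g y" for y w
        proof -
          have "q' * (w - y) \<le> q * (w - y)"
            using q' that by (intro mult_right_mono) auto
          with that show ?thesis by linarith
        qed
        then show ?thesis
          using q(1) unfolding hi_def small_slopes_def
          by (auto, meson order.strict_trans)
      qed
      then have "x \<notin> lo p"
        using sep[of p q'] p q' False by auto
      then obtain d where d: "0 < d" "\<And>y w. y < x \<Longrightarrow> x < w \<Longrightarrow> w - y < d \<Longrightarrow> p * (w - y) \<le> g w - g y"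
        unfolding lo_def small_slopes_def mem_Collect_eq by (meson not_less)
      have cm: "continuous_on UNIV (\<lambda>x. - g x)"
        using cont by (intro continuous_intros)
      have "(D - e) * (w - y) \<le> g w - g y" if yw: "y \<le> x" "x \<le> w" "w - y < d" for y w
      proof -
        have "- g w - - g y \<le> (- p) * (w - y)"
          by (rule slope_bound_closed[OF cm _ yw]) (use d(2) in fastforce)
        moreover have "(D - e) * (w - y) \<le> p * (w - y)"
          using p yw by (intro mult_right_mono) auto
        ultimately show ?thesis by simp
      qed
      then show ?thesis using d(1) by blast
    qed
    have "(g has_derivative (\<lambda>h. D * h)) (at x)"
      unfolding has_derivative_at_alt
    proof (intro conjI allI impI)
      show "bounded_linear (\<lambda>h. D * h)"
        by (rule bounded_linear_mult_right)
      fix e :: real assume e: "0 < e"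
      obtain d1 where d1: "0 < d1" "\<And>y w. y \<le> x \<Longrightarrow> x \<le> w \<Longrightarrow> w - y < d1 \<Longrightarrow> g w - g y \<le> (D + e) * (w - y)"
        using hi_ev[OF e] by blast
      obtain d2 where d2: "0 < d2" "\<And>y w. y \<le> x \<Longrightarrow> x \<le> w \<Longrightarrow> w - y < d2 \<Longrightarrow> (D - e) * (w - y) \<le> g w - g y"
        using lo_ev[OF e] by blast
      have "norm (g y - g x - D * (y - x)) \<le> e * norm (y - x)" if "norm (y - x) < min d1 d2" for y
      proof (cases "x \<le> y")
        case True
        then show ?thesis
          using d1(2)[of x y] d2(2)[of x y] that by (auto simp: abs_le_iff algebra_simps)
      next
        case False
        then show ?thesis
          using d1(2)[of y x] d2(2)[of y x] that by (auto simp: abs_le_iff algebra_simps)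
      qed
      then show "\<exists>d>0. \<forall>y. norm (y - x) < d \<longrightarrow> norm (g y - g x - D * (y - x)) \<le> e * norm (y - x)"
        using d1(1) d2(1) by (intro exI[of _ "min d1 d2"]) auto
    qed
    then have "((\<lambda>y. g y - L * y) has_derivative (\<lambda>h. D * h - L * h)) (at x)"
      by (intro derivative_intros)
    then show ?thesis
      unfolding g_def differentiable_def by auto
  qed
  ultimately show ?thesis
    by (intro AE_I'[of N]) auto
qed

section \<open>Fundamental theorem of calculus for Lipschitz functions\<close>

lemma has_vector_derivative_difference_quotient:
  fixes f :: "real \<Rightarrow> 'a::real_normed_vector"
  assumes "(f has_vector_derivative D) (at x)"
  shows "(\<lambda>n. real (Suc n) *\<^sub>R (f (x + 1 / real (Suc n)) - f x)) \<longlonglongrightarrow> D"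
proof -
  have "((\<lambda>h. norm (f (x + h) - f x - h *\<^sub>R D) / norm h) \<longlongrightarrow> 0) (at 0)"
    using assms unfolding has_vector_derivative_def has_derivative_at by simp
  moreover have "filterlim (\<lambda>n. 1 / real (Suc n)) (at 0) sequentially"
    by (auto simp: filterlim_at simp del: of_nat_Suc intro!: LIMSEQ_Suc[OF lim_1_over_n])
  ultimately have lim: "(\<lambda>n. norm (f (x + 1 / real (Suc n)) - f x - (1 / real (Suc n)) *\<^sub>R D) / norm (1 / real (Suc n)))
      \<longlonglongrightarrow> 0"
    by (rule filterlim_compose)
  have "norm (f (x + 1 / real (Suc n)) - f x - (1 / real (Suc n)) *\<^sub>R D) / norm (1 / real (Suc n))
      = norm (real (Suc n) *\<^sub>R (f (x + 1 / real (Suc n)) - f x) - D)" for n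
  proof -
    have "real (Suc n) *\<^sub>R (f (x + 1 / real (Suc n)) - f x) - D
        = real (Suc n) *\<^sub>R (f (x + 1 / real (Suc n)) - f x - (1 / real (Suc n)) *\<^sub>R D)"
      by (simp add: scaleR_diff_right)
    then show ?thesis
      by (simp add: mult.commute del: of_nat_Suc)
  qed
  with lim have "(\<lambda>n. norm (real (Suc n) *\<^sub>R (f (x + 1 / real (Suc n)) - f x) - D)) \<longlonglongrightarrow> 0"
    by simp
  then have "(\<lambda>n. real (Suc n) *\<^sub>R (f (x + 1 / real (Suc n)) - f x) - D) \<longlonglongrightarrow> 0"
    by (rule tendsto_norm_zero_cancel)
  then show ?thesis
    by (rule LIM_zero_cancel)
qed

text \<open>The difference quotients of \<open>f\<close> with step 1 / (n + 1) are bounded by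
  \<open>L\<close> and converge almost everywhere to \<open>f'\<close>, so dominated convergence
  applies. Their integrals are differences of the corresponding quotients of an antiderivative
  \<open>F\<close> of \<open>f\<close>, and these converge to \<open>f b - f a\<close>.\<close>

lemma lipschitz_FTC:
  fixes f f' :: "real \<Rightarrow> 'a::euclidean_space"
  assumes lip: "\<And>x y. norm (f x - f y) \<le> L * \<bar>x - y\<bar>"
    and der: "AE x in lebesgue. (f has_vector_derivative f' x) (at x)"
    and ab: "a \<le> b"
  shows "f' \<in> borel_measurable lebesgue"
    and "set_integrable lebesgue {a..b} f'"
    and "(LINT x:{a..b}|lebesgue. f' x) = f b - f a"
proof -
  define q where "q n x = real (Suc n) *\<^sub>R (f (x + 1 / real (Suc n)) - f x)" for n x
  have L0: "0 \<le> L"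
    using order_trans[OF norm_ge_zero lip[of 1 0]] by simp
  have cont: "continuous_on UNIV f"
  proof -
    have "L-lipschitz_on UNIV f"
      using lip L0 by (auto simp: lipschitz_on_def dist_norm)
    then show ?thesis
      by (rule lipschitz_on_continuous_on)
  qed
  have contq: "continuous_on UNIV (q n)" for n
    unfolding q_def
    by (intro continuous_intros continuous_on_compose2[OF cont]) auto
  have qm[measurable]: "q n \<in> borel_measurable lebesgue" for n
    using borel_measurable_continuous_onI[OF contq] by (simp add: measurable_completion)
  have lim: "AE x in lebesgue. (\<lambda>n. q n x) \<longlonglongrightarrow> f' x"
    using der unfolding q_def by eventually_elim (rule has_vector_derivative_difference_quotient)
  have "(\<lambda>x. lim (\<lambda>n. q n x)) \<in> borel_measurable lebesgue"
    by measurable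
  moreover have "AE x in lebesgue. lim (\<lambda>n. q n x) = f' x"
    using lim by eventually_elim (rule limI)
  ultimately show f'm[measurable]: "f' \<in> borel_measurable lebesgue"
    by (rule borel_measurable_AE)
  have qb: "norm (q n x) \<le> L" for n x
  proof -
    have "norm (q n x) = real (Suc n) * norm (f (x + 1 / real (Suc n)) - f x)"
      by (simp add: q_def del: of_nat_Suc)
    also have "\<dots> \<le> real (Suc n) * (L * (1 / real (Suc n)))"
      using lip[of "x + 1 / real (Suc n)" x] by (intro mult_left_mono) auto
    finally show ?thesis
      by simp
  qed
  have bnd: "integrable lebesgue (\<lambda>x. indicator {a..b} x *\<^sub>R L)"
    using ab by (intro integrable_scaleR_left integrable_real_indicator) auto
  have m1: "(\<lambda>x. indicator {a..b} x *\<^sub>R f' x) \<in> borel_measurable lebesgue"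
    and m2: "(\<lambda>x. indicator {a..b} x *\<^sub>R q n x) \<in> borel_measurable lebesgue" for n
    using f'm qm by (intro borel_measurable_scaleR borel_measurable_indicator; simp)+
  have limi: "AE x in lebesgue. (\<lambda>n. indicator {a..b} x *\<^sub>R q n x) \<longlonglongrightarrow> indicator {a..b} x *\<^sub>R f' x"
    using lim by eventually_elim (intro tendsto_intros)
  have dom: "AE x in lebesgue. norm (indicator {a..b} x *\<^sub>R q n x) \<le> indicator {a..b} x *\<^sub>R L" for n
    using qb L0 by (auto simp: indicator_def)
  show "set_integrable lebesgue {a..b} f'"
    unfolding set_integrable_def
    by (rule integrable_dominated_convergence[OF m1 m2 bnd limi dom])
  have conv: "(\<lambda>n. LINT x|lebesgue. indicator {a..b} x *\<^sub>R q n x) \<longlonglongrightarrow> (LINT x:{a..b}|lebesgue. f' x)"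
    unfolding set_lebesgue_integral_def
    by (rule integral_dominated_convergence[OF m1 m2 bnd limi dom])
  \<comment> \<open>Starting at \<open>a - 1\<close> makes \<open>a\<close> an interior point, so
    that \<open>F\<close> has a two-sided derivative there as well.\<close>
  define F where "F x = integral {a - 1..x} f" for x
  have F: "(F has_vector_derivative f x) (at x)" if "a \<le> x" for x
  proof -
    have "(F has_vector_derivative f x) (at x within {a - 1..x + 1})"
      unfolding F_def by (rule integral_has_vector_derivative) (use that cont continuous_on_subset in auto)
    moreover have "x \<in> interior {a - 1..x + 1}"
      using that by simp
    ultimately show ?thesis
      by (simp only: at_within_interior)
  qed
  define Q where "Q n x = real (Suc n) *\<^sub>R (F (x + 1 / real (Suc n)) - F x)" for n x
  have Q: "(Q n has_vector_derivative q n x) (at x)" if "a \<le> x" for n x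
  proof -
    have "a \<le> x + 1 / real (Suc n)"
      using that by (simp add: add_increasing2)
    then have "((F \<circ> (\<lambda>x. x + 1 / real (Suc n))) has_vector_derivative 1 *\<^sub>R f (x + 1 / real (Suc n))) (at x)"
      by (intro vector_diff_chain_at F) (auto intro!: derivative_eq_intros)
    then have "((\<lambda>x. F (x + 1 / real (Suc n))) has_vector_derivative f (x + 1 / real (Suc n))) (at x)"
      by (simp add: o_def)
    then show ?thesis
      unfolding Q_def q_def using F[OF that] by (auto intro!: derivative_eq_intros)
  qed
  have int_q: "(LINT x|lebesgue. indicator {a..b} x *\<^sub>R q n x) = Q n b - Q n a" for n
  proof -
    have "(LINT x|lebesgue. indicator {a..b} x *\<^sub>R q n x) = (LINT x|lborel. indicator {a..b} x *\<^sub>R q n x)"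
      by (rule integral_completion) (use borel_measurable_continuous_onI[OF contq[of n]] in measurable)
    also have "\<dots> = Q n b - Q n a"
      by (rule integral_FTC_atLeastAtMost[OF ab])
        (auto intro: has_vector_derivative_at_within Q continuous_on_subset[OF contq])
    finally show ?thesis .
  qed
  have "(\<lambda>n. Q n x) \<longlonglongrightarrow> f x" if "a \<le> x" for x
    unfolding Q_def by (rule has_vector_derivative_difference_quotient[OF F[OF that]])
  then have "(\<lambda>n. Q n b - Q n a) \<longlonglongrightarrow> f b - f a"
    using ab by (intro tendsto_diff) auto
  then show "(LINT x:{a..b}|lebesgue. f' x) = f b - f a"
    using conv unfolding int_q by (rule LIMSEQ_unique[rotated])
qed

section \<open>Cauchy transforms of probability measures\<close>

lemma norm_inverse_sub_real_le:
  assumes "Im z \<noteq> 0"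
  shows "norm (1 / (z - complex_of_real x)) \<le> 1 / \<bar>Im z\<bar>"
proof -
  have "\<bar>Im z\<bar> \<le> norm (z - complex_of_real x)"
    using abs_Im_le_cmod[of "z - complex_of_real x"] by simp
  with assms show ?thesis
    by (auto simp: norm_divide intro!: divide_left_mono mult_pos_pos)
qed

lemma sub_real_nonzero: "Im z \<noteq> 0 \<Longrightarrow> z - complex_of_real x \<noteq> 0"
  by (auto simp: complex_eq_iff)

lemma isCont_inverse_sub_real: "Im z \<noteq> 0 \<Longrightarrow> isCont (\<lambda>x. 1 / (z - complex_of_real x)) x"
  by (intro continuous_intros sub_real_nonzero)

lemma Re_inverse_sub_real:
  "Re (1 / (Complex s v - complex_of_real t)) = (s - t) / ((s - t)\<^sup>2 + v\<^sup>2)"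
  and Im_inverse_sub_real:
  "Im (1 / (Complex s v - complex_of_real t)) = - (v / ((s - t)\<^sup>2 + v\<^sup>2))"
  by (simp_all add: Re_divide Im_divide power2_eq_square)

lemma abs_arctan_le_half_pi: "\<bar>arctan x\<bar> \<le> pi / 2"
  using arctan_lbound[of x] arctan_ubound[of x] by linarith

context
  fixes \<mu> :: "real measure"
  assumes prob: "prob_space \<mu>" and sets_eq: "sets \<mu> = sets borel"
begin

interpretation prob_space \<mu> by (rule prob)

lemma measurable_borel_prob: "f \<in> borel_measurable borel \<Longrightarrow> f \<in> borel_measurable \<mu>"
  using measurable_cong_sets[OF sets_eq refl] by blast

lemma integrable_bounded_prob:
  fixes f :: "real \<Rightarrow> 'b::{banach, second_countable_topology}"
  assumes "f \<in> borel_measurable borel" "\<And>x. norm (f x) \<le> B"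
  shows "integrable \<mu> f"
  using assms by (intro integrable_const_bound[of _ B] measurable_borel_prob) auto

lemma cauchy_kernel_integrable:
  assumes "Im z \<noteq> 0"
  shows "integrable \<mu> (\<lambda>x. 1 / (z - complex_of_real x))"
  by (rule integrable_bounded_prob[OF _ norm_inverse_sub_real_le[OF assms]]) measurable

lemma norm_cauchy_transform_le:
  assumes "Im z \<noteq> 0"
  shows "norm (cauchy_transform \<mu> z) \<le> 1 / \<bar>Im z\<bar>"
proof -
  have "norm (cauchy_transform \<mu> z) \<le> (\<integral>x. norm (1 / (z - complex_of_real x)) \<partial>\<mu>)"
    unfolding cauchy_transform_def by (rule integral_norm_bound)
  also have "\<dots> \<le> (\<integral>x. 1 / \<bar>Im z\<bar> \<partial>\<mu>)"
    by (intro integral_mono integrable_norm cauchy_kernel_integrable assms norm_inverse_sub_real_le) simp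
  finally show ?thesis
    by (simp add: prob_space)
qed

lemma Re_cauchy_transform:
  "0 < v \<Longrightarrow> Re (cauchy_transform \<mu> (Complex s v)) = (\<integral>t. (s - t) / ((s - t)\<^sup>2 + v\<^sup>2) \<partial>\<mu>)"
  unfolding cauchy_transform_def
  by (subst integral_Re[symmetric]) (auto intro!: cauchy_kernel_integrable simp: Re_inverse_sub_real)

lemma Im_cauchy_transform:
  "0 < v \<Longrightarrow> Im (cauchy_transform \<mu> (Complex s v)) = - (\<integral>t. v / ((s - t)\<^sup>2 + v\<^sup>2) \<partial>\<mu>)"
  unfolding cauchy_transform_def
  by (subst integral_Im[symmetric]) (auto intro!: cauchy_kernel_integrable simp: Im_inverse_sub_real)

end

text \<open>An antiderivative in \<open>v\<close> is - arctan (u / v), which vanishes at infinity.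
  With u = s - t this is the inner integral of the Fubini argument for Re G. Nonnegative
  \<open>u\<close> comes first because the improper integral is taken of nonnegative functions;
  oddness in \<open>u\<close> does the rest.\<close>

lemma has_bochner_integral_conjugate_kernel:
  fixes u h :: real
  assumes h: "0 < h"
  shows "has_bochner_integral lborel (\<lambda>v. indicator {h..} v * (u / (u\<^sup>2 + v\<^sup>2))) (arctan (u / h))"
proof -
  have pos: "has_bochner_integral lborel (\<lambda>v. indicator {h..} v * (u / (u\<^sup>2 + v\<^sup>2))) (arctan (u / h))"
    if u: "0 \<le> u" for u :: real
  proof (rule has_bochner_integral_nn_integral)
    have "(\<integral>\<^sup>+v. ennreal (u / (u\<^sup>2 + v\<^sup>2)) * indicator {h..} v \<partial>lborel) = ennreal (0 - (- arctan (u / h)))"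
    proof (rule nn_integral_FTC_atLeast)
      fix v assume "h \<le> v"
      then have "0 < v" using h by simp
      then have "1 + (u / v)\<^sup>2 \<noteq> 0" "u\<^sup>2 + v\<^sup>2 \<noteq> 0"
        by (auto simp: add_nonneg_eq_0_iff)
      then show "((\<lambda>v. - arctan (u / v)) has_real_derivative u / (u\<^sup>2 + v\<^sup>2)) (at v)"
        using \<open>0 < v\<close> by (auto intro!: derivative_eq_intros simp: field_simps power2_eq_square)
    next
      have "((\<lambda>v. u / v) \<longlongrightarrow> 0) at_top"
        by (rule tendsto_divide_0[OF tendsto_const filterlim_at_top_imp_at_infinity[OF filterlim_ident]])
      then show "((\<lambda>v. - arctan (u / v)) \<longlongrightarrow> 0) at_top"
        using tendsto_minus[OF tendsto_arctan] by fastforce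
    qed (use u in auto)
    moreover have "ennreal (indicator {h..} v * (u / (u\<^sup>2 + v\<^sup>2))) = ennreal (u / (u\<^sup>2 + v\<^sup>2)) * indicator {h..} v" for v
      by (simp add: indicator_def)
    ultimately show "(\<integral>\<^sup>+v. ennreal (indicator {h..} v * (u / (u\<^sup>2 + v\<^sup>2))) \<partial>lborel) = ennreal (arctan (u / h))"
      by simp
  qed (use u h in auto)
  show ?thesis
  proof (cases "0 \<le> u")
    case False
    then have "has_bochner_integral lborel (\<lambda>v. - (indicator {h..} v * (- u / ((- u)\<^sup>2 + v\<^sup>2)))) (- arctan (- u / h))"
      by (intro has_bochner_integral_minus pos) simp
    then show ?thesis
      by (simp add: arctan_minus)
  qed (rule pos)
qed

text \<open>The source of the logarithm: both kinds of error reduce to a multiple of 1 / (v (1 + v))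
  above height \<open>h\<close>, where 1 / (1 + v) is the size of G and 1 / v comes from the kernel
  or from the perturbation.\<close>

lemma nn_integral_inverse_mult_Suc:
  assumes h: "0 < (h::real)" and c: "0 \<le> c"
  shows "(\<integral>\<^sup>+v. ennreal (c / (v * (1 + v))) * indicator {h..} v \<partial>lborel) = ennreal (c * ln (1 + 1 / h))"
proof -
  have "(\<integral>\<^sup>+v. ennreal (c / (v * (1 + v))) * indicator {h..} v \<partial>lborel) = ennreal (0 - (- (c * ln (1 + 1 / h))))"
  proof (rule nn_integral_FTC_atLeast)
    fix v assume "h \<le> v"
    then have "0 < v" using h by simp
    moreover have "0 < 1 + 1 / v" using \<open>0 < v\<close> by (simp add: add_pos_pos)
    ultimately show "((\<lambda>v. - (c * ln (1 + 1 / v))) has_real_derivative c / (v * (1 + v))) (at v)"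
      by (auto intro!: derivative_eq_intros simp: field_simps power2_eq_square)
  next
    have "((\<lambda>v::real. 1 / v) \<longlongrightarrow> 0) at_top"
      by (rule tendsto_divide_0[OF tendsto_const filterlim_at_top_imp_at_infinity[OF filterlim_ident]])
    then have "((\<lambda>v. - (c * ln (1 + 1 / v))) \<longlongrightarrow> - (c * ln (1 + 0))) at_top"
      by (intro tendsto_intros) auto
    then show "((\<lambda>v. - (c * ln (1 + 1 / v))) \<longlongrightarrow> 0) at_top"
      by simp
  qed (use h c in auto)
  then show ?thesis
    by simp
qed

text \<open>Read from right to left, this writes the majorant of the smoothing error as an integral
  over heights, a form in which it can be compared with the Poisson kernel.\<close>

lemma nn_integral_inverse_square_shift:
  assumes h: "0 < (h::real)" and u: "0 \<le> u"
  shows "(\<integral>\<^sup>+v. ennreal (h / (u + v)\<^sup>2) * indicator {h..} v \<partial>lborel) = ennreal (h / (u + h))"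
proof -
  have "(\<integral>\<^sup>+v. ennreal (h / (u + v)\<^sup>2) * indicator {h..} v \<partial>lborel) = ennreal (0 - (- (h / (u + h))))"
  proof (rule nn_integral_FTC_atLeast[where F = "\<lambda>v. - (h / (u + v))"])
    fix v assume "h \<le> v"
    then have "0 < u + v" using h u by simp
    then show "((\<lambda>v. - (h / (u + v))) has_real_derivative h / (u + v)\<^sup>2) (at v)"
      by (auto intro!: derivative_eq_intros simp: field_simps power2_eq_square)
  next
    have "filterlim (\<lambda>v. u + v) at_top at_top"
      by (rule filterlim_tendsto_add_at_top[OF tendsto_const filterlim_ident])
    then have "((\<lambda>v. h / (u + v)) \<longlongrightarrow> 0) at_top"
      by (intro tendsto_divide_0[OF tendsto_const] filterlim_at_top_imp_at_infinity)
    then show "((\<lambda>v. - (h / (u + v))) \<longlongrightarrow> 0) at_top"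
      using tendsto_minus by fastforce
  qed (use h u in auto)
  then show ?thesis
    by simp
qed

text \<open>With s = |u| / h both signs of \<open>u\<close> reduce to 1/2 - arctan s / pi \<le> 1 /
  (s + 1). For s \<le> 1 the right side is at least 1/2; for s > 1 the left side is arctan (1 / s) /
  pi, and arctan (1 / s) \<le> 1 / s \<le> 2 / (s + 1).\<close>

lemma arctan_step_le:
  fixes u h :: real
  assumes h: "0 < h"
  shows "\<bar>(if 0 \<le> u then 1 else 0) - (1 / 2 + arctan (u / h) / pi)\<bar> \<le> h / (\<bar>u\<bar> + h)"
proof -
  have main: "1 / 2 - arctan s / pi \<le> 1 / (s + 1)" if s: "0 \<le> s" for s :: real
  proof (cases "s \<le> 1")
    case True
    have "1 / 2 - arctan s / pi \<le> 1 / 2"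
      using s by simp
    also have "\<dots> \<le> 1 / (s + 1)"
      using s True by (simp add: field_simps)
    finally show ?thesis .
  next
    case False
    then have s1: "1 < s" by simp
    have "pi / 2 - arctan s = arctan (1 / s)"
      using arctan_inverse[of s] s1 by (simp add: sgn_if inverse_eq_divide)
    also have "\<dots> \<le> 1 / s"
      using s1 by (intro arctan_le_self) simp
    also have "\<dots> \<le> 2 / (s + 1)"
      using s1 by (simp add: field_simps)
    also have "\<dots> \<le> pi / (s + 1)"
      using s1 pi_ge_two by (intro divide_right_mono) auto
    finally have "(pi / 2 - arctan s) / pi \<le> (pi / (s + 1)) / pi"
      by (intro divide_right_mono) auto
    then show ?thesis
      by (simp add: diff_divide_distrib)
  qed
  have half: "0 \<le> 1 / 2 - arctan s / pi" for s
    using arctan_ubound[of s] by (simp add: field_simps)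
  have eq: "h / (\<bar>u\<bar> + h) = 1 / (\<bar>u\<bar> / h + 1)"
    using h by (simp add: field_simps)
  have ge: "0 \<le> \<bar>u\<bar> / h"
    using h by simp
  show ?thesis
  proof (cases "0 \<le> u")
    case True
    then show ?thesis
      using main[OF ge] half[of "u / h"] unfolding eq by simp
  next
    case False
    have *: "\<bar>u\<bar> / h = - (u / h)"
      using False by simp
    then have "arctan (\<bar>u\<bar> / h) = - arctan (u / h)"
      by (simp only: arctan_minus)
    then show ?thesis
      using main[OF ge] half[of "\<bar>u\<bar> / h"] False unfolding eq by (simp add: field_simps)
  qed
qed

section \<open>Cumulative functions recovered from the Cauchy transform on vertical
  half-lines\<close>

context
  fixes \<mu> :: "real measure"
  assumes prob: "prob_space \<mu>" and sets_eq: "sets \<mu> = sets borel"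
begin

interpretation prob_space \<mu> by (rule prob)
interpretation P: pair_sigma_finite \<mu> lborel ..

text \<open>Fubini is justified because the inner integral of absolute values is arctan (|s - t| /
  h), bounded by pi / 2 uniformly in \<open>t\<close>.\<close>

lemma cauchy_transform_vertical_integral:
  assumes h: "0 < h"
  shows "integrable lborel (\<lambda>v. indicator {h..} v * Re (cauchy_transform \<mu> (Complex s v)))"
    and "(\<integral>v. indicator {h..} v * Re (cauchy_transform \<mu> (Complex s v)) \<partial>lborel)
        = (\<integral>t. arctan ((s - t) / h) \<partial>\<mu>)"
proof -
  note sets_eq[measurable_cong]
  define f where "f t v = indicator {h..} v * ((s - t) / ((s - t)\<^sup>2 + v\<^sup>2))" for t v :: real
  have f_meas: "(\<lambda>(t, v). f t v) \<in> borel_measurable (\<mu> \<Otimes>\<^sub>M lborel)"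
    unfolding f_def by measurable
  have inner: "has_bochner_integral lborel (f t) (arctan ((s - t) / h))" for t
    unfolding f_def by (rule has_bochner_integral_conjugate_kernel[OF h])
  have inner_norm: "(\<integral>v. norm (f t v) \<partial>lborel) = arctan (\<bar>s - t\<bar> / h)" for t
  proof -
    have "norm (f t v) = indicator {h..} v * (\<bar>s - t\<bar> / (\<bar>s - t\<bar>\<^sup>2 + v\<^sup>2))" for v
      by (simp add: f_def abs_mult)
    then show ?thesis
      using has_bochner_integral_integral_eq[OF has_bochner_integral_conjugate_kernel[OF h, of "\<bar>s - t\<bar>"]]
      by simp
  qed
  have int: "integrable (\<mu> \<Otimes>\<^sub>M lborel) (\<lambda>(t, v). f t v)"
  proof (rule P.Fubini_integrable[OF f_meas])
    have "integrable \<mu> (\<lambda>t. arctan (\<bar>s - t\<bar> / h))"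
      by (rule integrable_bounded_prob[OF prob sets_eq, of _ "pi / 2"])
        (measurable, simp only: real_norm_def abs_arctan_le_half_pi)
    then show "integrable \<mu> (\<lambda>t. \<integral>v. norm (case (t, v) of (t, v) \<Rightarrow> f t v) \<partial>lborel)"
      by (simp only: inner_norm prod.case)
    show "AE t in \<mu>. integrable lborel (\<lambda>v. case (t, v) of (t, v) \<Rightarrow> f t v)"
      using inner by (simp add: has_bochner_integral_iff)
  qed
  have G: "(\<integral>t. f t v \<partial>\<mu>) = indicator {h..} v * Re (cauchy_transform \<mu> (Complex s v))" for v
    using h by (auto simp: f_def Re_cauchy_transform[OF prob sets_eq] indicator_def)
  show "integrable lborel (\<lambda>v. indicator {h..} v * Re (cauchy_transform \<mu> (Complex s v)))"
    using P.integrable_snd[OF int] by (simp add: G)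
  show "(\<integral>v. indicator {h..} v * Re (cauchy_transform \<mu> (Complex s v)) \<partial>lborel)
        = (\<integral>t. arctan ((s - t) / h) \<partial>\<mu>)"
    using P.Fubini_integral[OF int] by (simp add: G has_bochner_integral_integral_eq[OF inner])
qed

text \<open>The error is at most the integral of h / (|s - t| + h) against \<mu>. Writing this
  majorant as an integral over heights v \<ge> h and exchanging the integrals replaces it by (h / v)
  (- Im G(s + iv)), which the bound on |G| controls.\<close>

lemma smoothed_cdf_error:
  assumes h: "0 < h" and M: "0 \<le> M"
    and G: "\<And>v. h \<le> v \<Longrightarrow> norm (cauchy_transform \<mu> (Complex s v)) \<le> M / (1 + v)"
  shows "\<bar>measure \<mu> {..s} - (1 / 2 + (\<integral>t. arctan ((s - t) / h) \<partial>\<mu>) / pi)\<bar> \<le> M * (h * ln (1 + 1 / h))"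
proof -
  note sets_eq[measurable_cong]
  define k where "k t = h / (\<bar>s - t\<bar> + h)" for t
  have k_meas[measurable]: "k \<in> borel_measurable borel"
    unfolding k_def by measurable
  have k_bd: "0 \<le> k t" "k t \<le> 1" for t
    using h by (auto simp: k_def)
  have int_k: "integrable \<mu> k"
    by (rule integrable_bounded_prob[OF prob sets_eq k_meas, of 1]) (use k_bd in auto)
  have int_a: "integrable \<mu> (\<lambda>t. arctan ((s - t) / h))"
    by (rule integrable_bounded_prob[OF prob sets_eq, of _ "pi / 2"])
      (measurable, simp only: real_norm_def abs_arctan_le_half_pi)
  have int_i: "integrable \<mu> (indicator {..s} :: real \<Rightarrow> real)"
    by (rule integrable_bounded_prob[OF prob sets_eq, of _ 1]) auto
  have "measure \<mu> {..s} - (1 / 2 + (\<integral>t. arctan ((s - t) / h) \<partial>\<mu>) / pi)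
      = (\<integral>t. indicator {..s} t - (1 / 2 + arctan ((s - t) / h) / pi) \<partial>\<mu>)"
    using int_a int_i sets_eq by (simp add: prob_space)
  then have "\<bar>measure \<mu> {..s} - (1 / 2 + (\<integral>t. arctan ((s - t) / h) \<partial>\<mu>) / pi)\<bar>
      = \<bar>\<integral>t. indicator {..s} t - (1 / 2 + arctan ((s - t) / h) / pi) \<partial>\<mu>\<bar>"
    by (rule arg_cong)
  also have "\<dots> \<le> (\<integral>t. \<bar>indicator {..s} t - (1 / 2 + arctan ((s - t) / h) / pi)\<bar> \<partial>\<mu>)"
    by (rule integral_abs_bound)
  also have "\<dots> \<le> (\<integral>t. k t \<partial>\<mu>)"
  proof (rule integral_mono)
    show "\<bar>indicator {..s} t - (1 / 2 + arctan ((s - t) / h) / pi)\<bar> \<le> k t" for t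
      using arctan_step_le[OF h, of "s - t"] by (auto simp: k_def split: if_splits)
  qed (use int_k int_a int_i in auto)
  finally have le1: "\<bar>measure \<mu> {..s} - (1 / 2 + (\<integral>t. arctan ((s - t) / h) \<partial>\<mu>) / pi)\<bar> \<le> (\<integral>t. k t \<partial>\<mu>)" .
  have "ennreal (\<integral>t. k t \<partial>\<mu>) = (\<integral>\<^sup>+t. ennreal (k t) \<partial>\<mu>)"
    using int_k k_bd by (intro nn_integral_eq_integral[symmetric]) auto
  also have "\<dots> = (\<integral>\<^sup>+t. (\<integral>\<^sup>+v. ennreal (h / (\<bar>s - t\<bar> + v)\<^sup>2) * indicator {h..} v \<partial>lborel) \<partial>\<mu>)"
    by (simp add: nn_integral_inverse_square_shift[OF h] k_def)
  \<comment> \<open>Dropping the mixed term of (|s - t| + v)^2 leaves the denominator of the Poisson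
    kernel.\<close>
  also have "\<dots> \<le> (\<integral>\<^sup>+t. (\<integral>\<^sup>+v. ennreal (h / ((s - t)\<^sup>2 + v\<^sup>2)) * indicator {h..} v \<partial>lborel) \<partial>\<mu>)"
  proof (intro nn_integral_mono)
    fix t v :: real
    have "h / (\<bar>s - t\<bar> + v)\<^sup>2 \<le> h / ((s - t)\<^sup>2 + v\<^sup>2)" if "h \<le> v"
    proof (rule divide_left_mono)
      have "\<bar>s - t\<bar>\<^sup>2 = (s - t)\<^sup>2" by simp
      then show "(s - t)\<^sup>2 + v\<^sup>2 \<le> (\<bar>s - t\<bar> + v)\<^sup>2"
        using h that by (simp add: power2_sum)
      show "0 < (\<bar>s - t\<bar> + v)\<^sup>2 * ((s - t)\<^sup>2 + v\<^sup>2)"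
        using h that by (intro mult_pos_pos add_nonneg_pos zero_less_power) auto
    qed (use h in simp)
    then show "ennreal (h / (\<bar>s - t\<bar> + v)\<^sup>2) * indicator {h..} v
        \<le> ennreal (h / ((s - t)\<^sup>2 + v\<^sup>2)) * indicator {h..} v"
      by (auto simp: indicator_def intro!: ennreal_leI)
  qed
  also have "\<dots> = (\<integral>\<^sup>+v. (\<integral>\<^sup>+t. ennreal (h / ((s - t)\<^sup>2 + v\<^sup>2)) * indicator {h..} v \<partial>\<mu>) \<partial>lborel)"
    by (rule P.Fubini'[symmetric]) measurable
  also have "\<dots> \<le> (\<integral>\<^sup>+v. ennreal (h * M / (v * (1 + v))) * indicator {h..} v \<partial>lborel)"
  proof (intro nn_integral_mono)
    fix v :: real
    show "(\<integral>\<^sup>+t. ennreal (h / ((s - t)\<^sup>2 + v\<^sup>2)) * indicator {h..} v \<partial>\<mu>)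
        \<le> ennreal (h * M / (v * (1 + v))) * indicator {h..} v"
    proof (cases "h \<le> v")
      case True
      then have v: "0 < v" using h by simp
      have bd: "norm (v / ((s - t)\<^sup>2 + v\<^sup>2)) \<le> 1 / v" for t
        using norm_inverse_sub_real_le[of "Complex s v" t] v abs_Im_le_cmod[of "1 / (Complex s v - complex_of_real t)"]
        unfolding Im_inverse_sub_real by simp
      have int: "integrable \<mu> (\<lambda>t. v / ((s - t)\<^sup>2 + v\<^sup>2))"
        by (rule integrable_bounded_prob[OF prob sets_eq _ bd]) measurable
      have "(\<integral>\<^sup>+t. ennreal (h / ((s - t)\<^sup>2 + v\<^sup>2)) * indicator {h..} v \<partial>\<mu>)
          = (\<integral>\<^sup>+t. ennreal (h / v * (v / ((s - t)\<^sup>2 + v\<^sup>2))) \<partial>\<mu>)"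
        using True v by simp
      also have "\<dots> = ennreal (\<integral>t. h / v * (v / ((s - t)\<^sup>2 + v\<^sup>2)) \<partial>\<mu>)"
        using int h v by (intro nn_integral_eq_integral integrable_mult_right) auto
      also have "(\<integral>t. h / v * (v / ((s - t)\<^sup>2 + v\<^sup>2)) \<partial>\<mu>) = h / v * (- Im (cauchy_transform \<mu> (Complex s v)))"
        by (simp only: Im_cauchy_transform[OF prob sets_eq v] minus_minus integral_mult_right_zero)
      also have "\<dots> \<le> h / v * (M / (1 + v))"
      proof (rule mult_left_mono)
        show "- Im (cauchy_transform \<mu> (Complex s v)) \<le> M / (1 + v)"
          using G[OF True] abs_Im_le_cmod[of "cauchy_transform \<mu> (Complex s v)"] by linarith
      qed (use h v in auto)
      finally show ?thesis
        using True by (simp add: ennreal_leI)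
    qed simp
  qed
  also have "\<dots> = ennreal (h * M * ln (1 + 1 / h))"
    using h M by (intro nn_integral_inverse_mult_Suc) auto
  finally have "(\<integral>t. k t \<partial>\<mu>) \<le> h * M * ln (1 + 1 / h)"
    using h M by (subst (asm) ennreal_le_iff) (auto intro!: mult_nonneg_nonneg)
  with le1 show ?thesis
    by (simp add: mult_ac)
qed

end

text \<open>Triangle inequality through the two smoothed functions: their difference is an integral
  of Re (G1 - G2) over heights above \<open>h\<close> and contributes \<open>A\<close>, and each
  smoothing error contributes \<open>M\<close>. The normalising factor 1 / pi is estimated by
  1.\<close>

theorem cdf_diff_le_cauchy_transform_diff:
  fixes \<mu>1 \<mu>2 :: "real measure"
  assumes \<mu>1: "prob_space \<mu>1" "sets \<mu>1 = sets borel" and \<mu>2: "prob_space \<mu>2" "sets \<mu>2 = sets borel"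
    and h: "0 < h" and M: "0 \<le> M" and A: "0 \<le> A"
    and G1: "\<And>v. h \<le> v \<Longrightarrow> norm (cauchy_transform \<mu>1 (Complex s v)) \<le> M / (1 + v)"
    and G2: "\<And>v. h \<le> v \<Longrightarrow> norm (cauchy_transform \<mu>2 (Complex s v)) \<le> M / (1 + v)"
    and G12: "\<And>v. h \<le> v \<Longrightarrow> norm (cauchy_transform \<mu>1 (Complex s v) - cauchy_transform \<mu>2 (Complex s v))
                  \<le> A * h / (v * (1 + v))"
  shows "\<bar>measure \<mu>1 {..s} - measure \<mu>2 {..s}\<bar> \<le> (A + 2 * M) * (h * ln (1 + 1 / h))"
proof -
  define R where "R v = Re (cauchy_transform \<mu>1 (Complex s v)) - Re (cauchy_transform \<mu>2 (Complex s v))" for v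
  define a where "a \<mu> = (\<integral>t. arctan ((s - t) / h) \<partial>\<mu>)" for \<mu> :: "real measure"
  note i1 = cauchy_transform_vertical_integral[OF \<mu>1 h, of s]
  note i2 = cauchy_transform_vertical_integral[OF \<mu>2 h, of s]
  have intR: "integrable lborel (\<lambda>v. indicator {h..} v * R v)"
    using Bochner_Integration.integrable_diff[OF i1(1) i2(1)] by (simp add: R_def algebra_simps)
  have eq: "a \<mu>1 - a \<mu>2 = (\<integral>v. indicator {h..} v * R v \<partial>lborel)"
    using Bochner_Integration.integral_diff[OF i1(1) i2(1)]
    by (simp add: i1(2) i2(2) a_def R_def algebra_simps)
  have "ennreal \<bar>a \<mu>1 - a \<mu>2\<bar> \<le> ennreal (\<integral>v. \<bar>indicator {h..} v * R v\<bar> \<partial>lborel)"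
    unfolding eq by (intro ennreal_leI integral_abs_bound)
  also have "\<dots> = (\<integral>\<^sup>+v. ennreal \<bar>indicator {h..} v * R v\<bar> \<partial>lborel)"
    using intR by (intro nn_integral_eq_integral[symmetric]) auto
  also have "\<dots> \<le> (\<integral>\<^sup>+v. ennreal (A * h / (v * (1 + v))) * indicator {h..} v \<partial>lborel)"
  proof (rule nn_integral_mono)
    fix v :: real
    have "\<bar>R v\<bar> \<le> A * h / (v * (1 + v))" if "h \<le> v"
      using G12[OF that] abs_Re_le_cmod[of "cauchy_transform \<mu>1 (Complex s v) - cauchy_transform \<mu>2 (Complex s v)"]
      by (simp add: R_def)
    then show "ennreal \<bar>indicator {h..} v * R v\<bar> \<le> ennreal (A * h / (v * (1 + v))) * indicator {h..} v"
      by (auto simp: indicator_def intro!: ennreal_leI)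
  qed
  also have "\<dots> = ennreal (A * h * ln (1 + 1 / h))"
    using h A by (intro nn_integral_inverse_mult_Suc) auto
  finally have a: "\<bar>a \<mu>1 - a \<mu>2\<bar> \<le> A * h * ln (1 + 1 / h)"
    using h A by (subst (asm) ennreal_le_iff) (auto intro!: mult_nonneg_nonneg)
  have "\<bar>a \<mu>1 / pi - a \<mu>2 / pi\<bar> = \<bar>a \<mu>1 - a \<mu>2\<bar> / pi"
    by (simp add: diff_divide_distrib[symmetric])
  also have "\<dots> \<le> \<bar>a \<mu>1 - a \<mu>2\<bar> / 1"
    using pi_ge_two by (intro divide_left_mono) auto
  finally have "\<bar>a \<mu>1 / pi - a \<mu>2 / pi\<bar> \<le> A * (h * ln (1 + 1 / h))"
    using a by (simp add: mult_ac)
  moreover have "\<bar>measure \<mu>1 {..s} - (1 / 2 + a \<mu>1 / pi)\<bar> \<le> M * (h * ln (1 + 1 / h))"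
    unfolding a_def by (rule smoothed_cdf_error[OF \<mu>1 h M G1])
  moreover have "\<bar>measure \<mu>2 {..s} - (1 / 2 + a \<mu>2 / pi)\<bar> \<le> M * (h * ln (1 + 1 / h))"
    unfolding a_def by (rule smoothed_cdf_error[OF \<mu>2 h M G2])
  ultimately show ?thesis
    unfolding distrib_right by linarith
qed

text \<open>The vertical integral determines every arctan smoothing of the cumulative function from
  G, so it suffices to choose smoothings that converge to the cumulative function at every point,
  atoms included.\<close>

theorem cauchy_transform_inject:
  fixes \<mu>1 \<mu>2 :: "real measure"
  assumes \<mu>1: "prob_space \<mu>1" "sets \<mu>1 = sets borel" and \<mu>2: "prob_space \<mu>2" "sets \<mu>2 = sets borel"
    and eq: "\<And>z. 0 < Im z \<Longrightarrow> cauchy_transform \<mu>1 z = cauchy_transform \<mu>2 z"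
  shows "\<mu>1 = \<mu>2"
proof -
  \<comment> \<open>Approaching \<open>s\<close> from the right more slowly than the smoothing scale \<open>1 / (n + 1)\<^sup>2\<close> puts a
    possible atom at \<open>s\<close> entirely to the left.\<close>
  define k where "k s n t = arctan ((s + 1 / real (Suc n) - t) * (real (Suc n))\<^sup>2)" for s n t
  have k_lim: "(\<lambda>n. k s n t) \<longlonglongrightarrow> pi * indicator {..s} t - pi / 2" for s t
  proof (cases "t \<le> s")
    case True
    have "filterlim (\<lambda>n. (s + 1 / real (Suc n) - t) * (real (Suc n))\<^sup>2) at_top sequentially"
    proof (rule filterlim_at_top_mono)
      show "filterlim (\<lambda>n. real (Suc n)) at_top sequentially"
        by (rule filterlim_compose[OF filterlim_real_sequentially filterlim_Suc])
      have "real (Suc n) \<le> (s + 1 / real (Suc n) - t) * (real (Suc n))\<^sup>2" for n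
      proof -
        have "real (Suc n) = (1 / real (Suc n)) * (real (Suc n))\<^sup>2"
          by (simp add: power2_eq_square)
        also have "\<dots> \<le> (s + 1 / real (Suc n) - t) * (real (Suc n))\<^sup>2"
          using True by (intro mult_right_mono) auto
        finally show ?thesis .
      qed
      then show "\<forall>\<^sub>F n in sequentially. real (Suc n) \<le> (s + 1 / real (Suc n) - t) * (real (Suc n))\<^sup>2"
        by simp
    qed
    then have "(\<lambda>n. k s n t) \<longlonglongrightarrow> pi / 2"
      unfolding k_def by (rule filterlim_compose[OF tendsto_arctan_at_top])
    with True show ?thesis by simp
  next
    case False
    have "(\<lambda>n. s + 1 / real (Suc n) - t) \<longlonglongrightarrow> s + 0 - t"
      by (intro tendsto_intros LIMSEQ_Suc[OF lim_1_over_n])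
    then have "filterlim (\<lambda>n. (s + 1 / real (Suc n) - t) * (real (Suc n))\<^sup>2) at_bot sequentially"
    proof (rule filterlim_tendsto_neg_mult_at_bot)
      show "s + 0 - t < 0" using False by simp
      show "filterlim (\<lambda>n. (real (Suc n))\<^sup>2) at_top sequentially"
        by (intro filterlim_pow_at_top filterlim_compose[OF filterlim_real_sequentially filterlim_Suc]) simp
    qed
    then have "(\<lambda>n. k s n t) \<longlonglongrightarrow> - (pi / 2)"
      unfolding k_def by (rule filterlim_compose[OF tendsto_arctan_at_bot])
    with False show ?thesis by simp
  qed
  have conv: "(\<lambda>n. \<integral>t. k s n t \<partial>\<mu>) \<longlonglongrightarrow> pi * measure \<mu> {..s} - pi / 2"
    if \<mu>: "prob_space \<mu>" "sets \<mu> = sets borel" for \<mu> s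
  proof -
    interpret prob_space \<mu> by (rule \<mu>)
    have "(\<lambda>n. \<integral>t. k s n t \<partial>\<mu>) \<longlonglongrightarrow> (\<integral>t. pi * indicator {..s} t - pi / 2 \<partial>\<mu>)"
    proof (rule integral_dominated_convergence[where w = "\<lambda>_. pi / 2"])
      show "AE t in \<mu>. norm (k s n t) \<le> pi / 2" for n
        unfolding k_def real_norm_def by (intro AE_I2 abs_arctan_le_half_pi)
    qed (use k_lim in \<open>auto simp: k_def intro!: measurable_borel_prob[OF \<mu>]\<close>)
    moreover have "integrable \<mu> (indicator {..s} :: real \<Rightarrow> real)"
      by (rule integrable_bounded_prob[OF \<mu>, of _ 1]) auto
    ultimately show ?thesis
      using \<mu>(2) by (simp add: prob_space)
  qed
  have keq: "(\<integral>t. k s n t \<partial>\<mu>1) = (\<integral>t. k s n t \<partial>\<mu>2)" for s n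
  proof -
    define h where "h = 1 / (real (Suc n))\<^sup>2"
    have h: "0 < h" unfolding h_def by simp
    have k: "k s n t = arctan ((s + 1 / real (Suc n) - t) / h)" for t
      by (simp add: k_def h_def)
    have "indicator {h..} v * Re (cauchy_transform \<mu>1 (Complex (s + 1 / real (Suc n)) v))
        = indicator {h..} v * Re (cauchy_transform \<mu>2 (Complex (s + 1 / real (Suc n)) v))" for v :: real
      using h by (auto simp: indicator_def eq)
    then show ?thesis
      unfolding k cauchy_transform_vertical_integral(2)[OF \<mu>1 h, symmetric]
        cauchy_transform_vertical_integral(2)[OF \<mu>2 h, symmetric]
      by (intro Bochner_Integration.integral_cong refl)
  qed
  have "measure \<mu>1 {..s} = measure \<mu>2 {..s}" for s
    using LIMSEQ_unique[OF conv[OF \<mu>1, of s] conv[OF \<mu>2, of s, folded keq]] by simp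
  then have "cdf \<mu>1 = cdf \<mu>2"
    by (simp add: cdf_def fun_eq_iff)
  moreover have "real_distribution \<mu>1" "real_distribution \<mu>2"
    using \<mu>1 \<mu>2 by (auto intro!: real_distribution.intro simp: real_distribution_axioms_def sets_eq_imp_space_eq)
  ultimately show ?thesis
    by (intro cdf_unique)
qed

section \<open>Measures with a prescribed density of falling slopes\<close>

lemma set_integrable_lebesgue_Icc_bounded:
  fixes f :: "real \<Rightarrow> 'b::euclidean_space"
  assumes "f \<in> borel_measurable lebesgue" "\<And>x. norm (f x) \<le> B"
  shows "set_integrable lebesgue {a..b} f"
  unfolding set_integrable_def
proof (rule Bochner_Integration.integrable_bound)
  show "integrable lebesgue (\<lambda>x. indicator {a..b} x *\<^sub>R B)"
    by (intro integrable_scaleR_left integrable_real_indicator) (cases "a \<le> b"; simp)+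
  show "(\<lambda>x. indicator {a..b} x *\<^sub>R f x) \<in> borel_measurable lebesgue"
    using assms(1) by (intro borel_measurable_scaleR borel_measurable_indicator) auto
  show "AE x in lebesgue. norm (indicator {a..b} x *\<^sub>R f x) \<le> norm (indicator {a..b} x *\<^sub>R B)"
    using order_trans[OF assms(2) abs_ge_self] by (auto simp: indicator_def)
qed

lemma norm_set_integral_Icc_le:
  fixes f :: "real \<Rightarrow> 'b::euclidean_space"
  assumes "set_integrable lebesgue {a..b} f" "\<And>x. x \<in> {a..b} \<Longrightarrow> norm (f x) \<le> B" "a \<le> b"
  shows "norm (LINT x:{a..b}|lebesgue. f x) \<le> B * (b - a)"
proof -
  have "norm (LINT x:{a..b}|lebesgue. f x) \<le> (LINT x:{a..b}|lebesgue. norm (f x))"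
    by (rule set_integral_norm_bound[OF assms(1)])
  also have "\<dots> \<le> (LINT x:{a..b}|lebesgue. B)"
    using assms by (intro set_integral_mono set_integrable_norm) (auto simp: set_integrable_def)
  also have "\<dots> = B * (b - a)"
    using assms(3) by (subst set_integral_const) auto
  finally show ?thesis .
qed

lemma set_integral_Icc_combine:
  fixes f :: "real \<Rightarrow> 'b::euclidean_space"
  assumes "a \<le> b" "b \<le> c" "set_integrable lebesgue {a..c} f"
  shows "(LINT x:{a..c}|lebesgue. f x) = (LINT x:{a..b}|lebesgue. f x) + (LINT x:{b..c}|lebesgue. f x)"
proof -
  have "AE x in lebesgue. x \<noteq> b"
    by (rule AE_I'[of "{b}"]) (auto simp: negligible_iff_null_sets[symmetric])
  then have "AE x in lebesgue. \<not> (x \<in> {a..b} \<and> x \<in> {b..c})"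
    by eventually_elim auto
  moreover have "{a..c} = {a..b} \<union> {b..c}"
    using assms(1,2) by auto
  moreover have "set_integrable lebesgue {a..b} f" "set_integrable lebesgue {b..c} f"
    using assms by (auto intro: set_integrable_subset[OF assms(3)])
  ultimately show ?thesis
    using set_integral_Un_AE[of "{a..b}" "{b..c}" lebesgue f] by simp
qed

text \<open>An antiderivative is - Ln (z - w), where z - w avoids the branch cut because z is not
  real. Thus density 1 on a segment contributes exactly one factor of an interlacing
  product.\<close>

lemma exp_integral_inverse_sub_real:
  assumes z: "Im z \<noteq> 0" and "a \<le> b"
  shows "exp (LINT w:{a..b}|lebesgue. 1 / (z - complex_of_real w))
    = (z - complex_of_real a) / (z - complex_of_real b)"
proof -
  have nz: "z - complex_of_real w \<notin> \<real>\<^sub>\<le>\<^sub>0" for w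
    using z by (simp add: complex_nonpos_Reals_iff)
  have "(LINT w:{a..b}|lebesgue. 1 / (z - complex_of_real w))
      = (\<integral>w. indicator {a..b} w *\<^sub>R (1 / (z - complex_of_real w)) \<partial>lborel)"
    unfolding set_lebesgue_integral_def by (rule integral_completion) measurable
  also have "\<dots> = - Ln (z - complex_of_real b) - (- Ln (z - complex_of_real a))"
  proof (rule integral_FTC_atLeastAtMost[OF \<open>a \<le> b\<close>])
    fix w :: real
    have "((\<lambda>u. z - u) has_field_derivative (0 - 1)) (at (complex_of_real w))"
      by (intro derivative_intros)
    from DERIV_minus[OF DERIV_chain2[OF has_field_derivative_Ln[OF nz] this]]
    have "((\<lambda>w. - Ln (z - w)) has_field_derivative 1 / (z - complex_of_real w)) (at (complex_of_real w))"
      by (simp add: divide_inverse)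
    then show "((\<lambda>w. - Ln (z - complex_of_real w)) has_vector_derivative 1 / (z - complex_of_real w)) (at w within {a..b})"
      by (rule has_vector_derivative_at_within[OF has_vector_derivative_real_field])
    show "continuous_on {a..b} (\<lambda>w. 1 / (z - complex_of_real w))"
      using sub_real_nonzero[OF z] by (intro continuous_intros) auto
  qed
  finally show ?thesis
    using sub_real_nonzero[OF z] by (simp add: exp_diff)
qed

text \<open>Adding the pair \<open>(t, x)\<close> with \<open>y \<le> t \<le> x\<close> on the support splits the mass at \<open>y\<close> between
  \<open>y\<close> and \<open>x\<close> in the proportion given by the partial fraction expansion of
  \<open>(z - t) / ((z - y) (z - x))\<close>.\<close>

lemma pmf_cauchy_transform_extend:
  fixes p :: "real pmf"
  assumes p: "finite (set_pmf p)" "set_pmf p \<subseteq> {c..t}" and tx: "t \<le> x"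
  obtains p' :: "real pmf" where "finite (set_pmf p')" "set_pmf p' \<subseteq> {c..x}"
    "\<And>z. Im z \<noteq> 0 \<Longrightarrow> (\<integral>y. 1 / (z - complex_of_real y) \<partial>measure_pmf p')
        = (\<integral>y. 1 / (z - complex_of_real y) \<partial>measure_pmf p)
          * ((z - complex_of_real t) / (z - complex_of_real x))"
proof (cases "t = x")
  case True
  then show ?thesis
    using p sub_real_nonzero by (intro that[of p]) auto
next
  case False
  then have tx: "t < x" using tx by simp
  define q where "q y = map_pmf (\<lambda>b. if b then y else x) (bernoulli_pmf ((t - y) / (x - y)))" for y
  have ct: "c \<le> t"
    using set_pmf_not_empty[of p] p(2) by force
  have fin: "finite (set_pmf (q y))" for y
    unfolding q_def by simp
  have set_q: "set_pmf (q y) \<subseteq> {y, x}" for y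
    unfolding q_def by auto
  show ?thesis
  proof (rule that[of "bind_pmf p q"])
    show "finite (set_pmf (bind_pmf p q))"
      using p fin by simp
    show "set_pmf (bind_pmf p q) \<subseteq> {c..x}"
      using p(2) set_q tx ct by (fastforce simp: set_bind_pmf)
    fix z :: complex assume z: "Im z \<noteq> 0"
    define k where "k = (\<lambda>y. 1 / (z - complex_of_real y))"
    have step: "(\<integral>y. k y \<partial>measure_pmf (q y0)) = k y0 * ((z - complex_of_real t) / (z - complex_of_real x))"
      if "y0 \<in> set_pmf p" for y0
    proof -
      have y0: "y0 \<le> t" using that p(2) by auto
      define A where "A = (t - y0) / (x - y0)"
      have A: "0 \<le> A" "A \<le> 1"
        using y0 tx by (auto simp: A_def)
      have "(\<integral>y. k y \<partial>measure_pmf (q y0)) = A *\<^sub>R k y0 + (1 - A) *\<^sub>R k x"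
        unfolding q_def A_def[symmetric] integral_map_pmf
        using A by (subst integral_measure_pmf[of UNIV]) (auto simp: UNIV_bool)
      also have "\<dots> = k y0 * ((z - complex_of_real t) / (z - complex_of_real x))"
      proof -
        have "A * (x - y0) = t - y0"
          using y0 tx unfolding A_def by simp
        then have "complex_of_real A * (complex_of_real x - complex_of_real y0) = complex_of_real t - complex_of_real y0"
          by (simp only: of_real_diff[symmetric] of_real_mult[symmetric])
        moreover have "(1 - complex_of_real A) * (z - complex_of_real y0) + complex_of_real A * (z - complex_of_real x)
            = (z - complex_of_real y0) - complex_of_real A * (complex_of_real x - complex_of_real y0)"
          by (simp add: algebra_simps)
        ultimately have "(1 - complex_of_real A) * (z - complex_of_real y0) + complex_of_real A * (z - complex_of_real x)
            = z - complex_of_real t"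
          by simp
        moreover have "A *\<^sub>R k y0 + (1 - A) *\<^sub>R k x
            = ((1 - complex_of_real A) * (z - complex_of_real y0) + complex_of_real A * (z - complex_of_real x))
              / ((z - complex_of_real y0) * (z - complex_of_real x))"
          using sub_real_nonzero[OF z] by (simp add: k_def scaleR_conv_of_real add_divide_distrib)
        ultimately show ?thesis
          by (simp add: k_def)
      qed
      finally show ?thesis .
    qed
    have "(\<integral>y. k y \<partial>measure_pmf (bind_pmf p q)) = (\<Sum>y\<in>set_pmf p. pmf p y *\<^sub>R (\<integral>y'. k y' \<partial>measure_pmf (q y)))"
      by (rule pmf_expectation_bind[OF p(1) fin order_refl])
    also have "\<dots> = (\<Sum>y\<in>set_pmf p. pmf p y *\<^sub>R k y) * ((z - complex_of_real t) / (z - complex_of_real x))"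
      unfolding sum_distrib_right by (intro sum.cong refl) (simp only: step mult_scaleR_left)
    also have "(\<Sum>y\<in>set_pmf p. pmf p y *\<^sub>R k y) = (\<integral>y. k y \<partial>measure_pmf p)"
      using p(1) by (subst integral_measure_pmf[of "set_pmf p"]) auto
    finally show "(\<integral>y. 1 / (z - complex_of_real y) \<partial>measure_pmf (bind_pmf p q))
        = (\<integral>y. 1 / (z - complex_of_real y) \<partial>measure_pmf p) * ((z - complex_of_real t) / (z - complex_of_real x))"
      unfolding k_def .
  qed
qed

section \<open>Discretisation of a density with values in [0, 1]\<close>

lemma measurable_lebesgue_inverse_sub_real:
  "(\<lambda>w. 1 / (z - complex_of_real w)) \<in> borel_measurable lebesgue"
  by (rule measurable_completion) simp

lemma measurable_density_kernel:
  fixes \<rho> :: "real \<Rightarrow> real"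
  assumes [measurable]: "\<rho> \<in> borel_measurable lebesgue"
  shows "(\<lambda>w. complex_of_real (\<rho> w) / (z - complex_of_real w)) \<in> borel_measurable lebesgue"
proof -
  have "(\<lambda>w. complex_of_real (\<rho> w)) \<in> borel_measurable lebesgue"
    by (rule measurable_compose[OF assms]) measurable
  then have "(\<lambda>w. complex_of_real (\<rho> w) * (1 / (z - complex_of_real w))) \<in> borel_measurable lebesgue"
    by (intro borel_measurable_times measurable_lebesgue_inverse_sub_real)
  then show ?thesis
    by simp
qed

lemma norm_density_kernel_le:
  assumes "\<bar>\<rho> w\<bar> \<le> B" "Im z \<noteq> 0"
  shows "norm (complex_of_real (\<rho> w) / (z - complex_of_real w)) \<le> B / \<bar>Im z\<bar>"
proof -
  have "norm (complex_of_real (\<rho> w) / (z - complex_of_real w)) = \<bar>\<rho> w\<bar> * norm (1 / (z - complex_of_real w))"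
    by (simp add: norm_divide)
  also have "\<dots> \<le> B * (1 / \<bar>Im z\<bar>)"
    using assms order_trans[OF abs_ge_zero assms(1)] norm_inverse_sub_real_le[OF assms(2)]
    by (intro mult_mono) auto
  finally show ?thesis by simp
qed

lemma set_integrable_density_kernel:
  fixes \<rho> :: "real \<Rightarrow> real"
  assumes "\<rho> \<in> borel_measurable lebesgue" "\<And>w. \<bar>\<rho> w\<bar> \<le> B" "Im z \<noteq> 0"
  shows "set_integrable lebesgue {a..b} (\<lambda>w. complex_of_real (\<rho> w) / (z - complex_of_real w))"
  using assms by (intro set_integrable_lebesgue_Icc_bounded[of _ "B / \<bar>Im z\<bar>"] measurable_density_kernel norm_density_kernel_le)

lemma density_kernel_cell_error:
  fixes \<rho> :: "real \<Rightarrow> real"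
  assumes \<rho>: "\<rho> \<in> borel_measurable lebesgue" "\<And>w. \<bar>\<rho> w\<bar> \<le> 1" and z: "Im z \<noteq> 0" and \<eta>: "0 \<le> \<eta>"
  shows "norm ((LINT w:{t..t + \<eta>}|lebesgue. complex_of_real (\<rho> w) / (z - complex_of_real w))
      - complex_of_real (LINT w:{t..t + \<eta>}|lebesgue. \<rho> w) / (z - complex_of_real t)) \<le> \<eta>\<^sup>2 / (Im z)\<^sup>2"
proof -
  have i1: "set_integrable lebesgue {t..t + \<eta>} (\<lambda>w. complex_of_real (\<rho> w) / (z - complex_of_real w))"
    using set_integrable_density_kernel[OF \<rho> z] .
  have i0: "set_integrable lebesgue {t..t + \<eta>} \<rho>"
    using \<rho> by (intro set_integrable_lebesgue_Icc_bounded[of _ 1]) auto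
  have i2: "set_integrable lebesgue {t..t + \<eta>} (\<lambda>w. complex_of_real (\<rho> w) * (1 / (z - complex_of_real t)))"
  proof (rule set_integrable_lebesgue_Icc_bounded)
    have "(\<lambda>w. complex_of_real (\<rho> w)) \<in> borel_measurable lebesgue"
      by (rule measurable_compose[OF \<rho>(1)]) measurable
    then show "(\<lambda>w. complex_of_real (\<rho> w) * (1 / (z - complex_of_real t))) \<in> borel_measurable lebesgue"
      by (intro borel_measurable_times) auto
    show "norm (complex_of_real (\<rho> w) * (1 / (z - complex_of_real t))) \<le> 1 * norm (1 / (z - complex_of_real t))" for w
      unfolding norm_mult using \<rho>(2) by (intro mult_right_mono) auto
  qed
  have eq: "complex_of_real (LINT w:{t..t + \<eta>}|lebesgue. \<rho> w) / (z - complex_of_real t)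
      = (LINT w:{t..t + \<eta>}|lebesgue. complex_of_real (\<rho> w) * (1 / (z - complex_of_real t)))"
    by (simp add: set_integral_complex_of_real)
  have "norm ((LINT w:{t..t + \<eta>}|lebesgue. complex_of_real (\<rho> w) / (z - complex_of_real w)
      - complex_of_real (\<rho> w) * (1 / (z - complex_of_real t)))) \<le> (\<eta> / (Im z)\<^sup>2) * (t + \<eta> - t)"
  proof (rule norm_set_integral_Icc_le)
    fix w assume w: "w \<in> {t..t + \<eta>}"
    have "complex_of_real (\<rho> w) / (z - complex_of_real w) - complex_of_real (\<rho> w) * (1 / (z - complex_of_real t))
        = complex_of_real (\<rho> w) * complex_of_real (w - t) * ((1 / (z - complex_of_real w)) * (1 / (z - complex_of_real t)))"
      using sub_real_nonzero[OF z] by (simp add: field_simps)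
    also have "norm \<dots> = \<bar>\<rho> w\<bar> * \<bar>w - t\<bar> * (norm (1 / (z - complex_of_real w)) * norm (1 / (z - complex_of_real t)))"
      by (simp only: norm_mult norm_of_real)
    also have "\<dots> \<le> 1 * \<eta> * ((1 / \<bar>Im z\<bar>) * (1 / \<bar>Im z\<bar>))"
      using w \<rho>(2)[of w] norm_inverse_sub_real_le[OF z] \<eta> by (intro mult_mono) auto
    finally show "norm (complex_of_real (\<rho> w) / (z - complex_of_real w) - complex_of_real (\<rho> w) * (1 / (z - complex_of_real t)))
        \<le> \<eta> / (Im z)\<^sup>2"
      by (simp add: power2_eq_square)
  qed (use \<eta> i1 i2 in \<open>auto intro!: set_integral_diff\<close>)
  also have "\<dots> = \<eta>\<^sup>2 / (Im z)\<^sup>2"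
    by (simp add: power2_eq_square)
  finally show ?thesis
    unfolding eq set_integral_diff(2)[OF i1 i2] .
qed

text \<open>On each cell the density is replaced by the indicator of an initial segment of the same
  mass; 0 \<le> \<rho> \<le> 1 makes the segment fit into the cell. Each segment adds a factor of an
  interlacing product, realised by \<open>pmf_cauchy_transform_extend\<close>. Carrying the exponent
  \<open>S\<close> as a witness avoids choosing a branch of the logarithm.\<close>

lemma pmf_approximates_density:
  fixes \<rho> :: "real \<Rightarrow> real"
  assumes \<rho>: "\<rho> \<in> borel_measurable lebesgue" "\<And>w. 0 \<le> \<rho> w" "\<And>w. \<rho> w \<le> 1" and \<eta>: "0 \<le> \<eta>"
  shows "\<exists>p::real pmf. finite (set_pmf p) \<and> set_pmf p \<subseteq> {c..c + real n * \<eta>} \<and>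
     (\<forall>z. Im z \<noteq> 0 \<longrightarrow> (\<exists>S. (\<integral>y. 1 / (z - complex_of_real y) \<partial>measure_pmf p) = exp S / (z - complex_of_real c) \<and>
       norm (S - (LINT w:{c..c + real n * \<eta>}|lebesgue. complex_of_real (\<rho> w) / (z - complex_of_real w)))
         \<le> real n * (2 * \<eta>\<^sup>2 / (Im z)\<^sup>2)))"
proof (induction n)
  case 0
  have "(LINT w:{c..c}|lebesgue. complex_of_real (\<rho> w) / (z - complex_of_real w)) = 0" if z: "Im z \<noteq> 0" for z
  proof -
    have "norm (LINT w:{c..c}|lebesgue. complex_of_real (\<rho> w) / (z - complex_of_real w)) \<le> 1 / \<bar>Im z\<bar> * (c - c)"
    proof (rule norm_set_integral_Icc_le)
      show "set_integrable lebesgue {c..c} (\<lambda>w. complex_of_real (\<rho> w) / (z - complex_of_real w))"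
        by (rule set_integrable_density_kernel[of _ 1]) (use \<rho> z in auto)
      show "norm (complex_of_real (\<rho> w) / (z - complex_of_real w)) \<le> 1 / \<bar>Im z\<bar>" for w
        using \<rho> z by (intro norm_density_kernel_le) auto
    qed simp
    then show ?thesis by simp
  qed
  then show ?case
    by (intro exI[of _ "return_pmf c"]) (auto intro!: exI[of _ 0])
next
  case (Suc n)
  define t where "t = c + real n * \<eta>"
  have t': "c + real (Suc n) * \<eta> = t + \<eta>" "c \<le> t"
    using \<eta> by (auto simp: t_def algebra_simps)
  have \<rho>_abs: "\<bar>\<rho> w\<bar> \<le> 1" for w
    using \<rho>(2,3)[of w] by simp
  obtain p where p: "finite (set_pmf p)" "set_pmf p \<subseteq> {c..t}"
    and pz: "\<And>z. Im z \<noteq> 0 \<Longrightarrow> \<exists>S. (\<integral>y. 1 / (z - complex_of_real y) \<partial>measure_pmf p) = exp S / (z - complex_of_real c) \<and>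
       norm (S - (LINT w:{c..t}|lebesgue. complex_of_real (\<rho> w) / (z - complex_of_real w))) \<le> real n * (2 * \<eta>\<^sup>2 / (Im z)\<^sup>2)"
    using Suc.IH unfolding t_def by blast
  define m where "m = (LINT w:{t..t + \<eta>}|lebesgue. \<rho> w)"
  have i0: "set_integrable lebesgue {t..t + \<eta>} \<rho>"
    using \<rho> by (intro set_integrable_lebesgue_Icc_bounded[of _ 1]) auto
  have m: "0 \<le> m" "m \<le> \<eta>"
  proof -
    show "0 \<le> m"
      unfolding m_def using \<rho>(2) by (simp add: set_lebesgue_integral_def)
    show "m \<le> \<eta>"
      using norm_set_integral_Icc_le[OF i0, of 1] \<rho>_abs \<eta> by (simp add: m_def)
  qed
  obtain p' where p': "finite (set_pmf p')" "set_pmf p' \<subseteq> {c..t + m}"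
    and p'z: "\<And>z. Im z \<noteq> 0 \<Longrightarrow> (\<integral>y. 1 / (z - complex_of_real y) \<partial>measure_pmf p')
        = (\<integral>y. 1 / (z - complex_of_real y) \<partial>measure_pmf p)
          * ((z - complex_of_real t) / (z - complex_of_real (t + m)))"
    using pmf_cauchy_transform_extend[OF p, of "t + m"] m by auto
  have "\<exists>S. (\<integral>y. 1 / (z - complex_of_real y) \<partial>measure_pmf p') = exp S / (z - complex_of_real c) \<and>
       norm (S - (LINT w:{c..t + \<eta>}|lebesgue. complex_of_real (\<rho> w) / (z - complex_of_real w)))
         \<le> real (Suc n) * (2 * \<eta>\<^sup>2 / (Im z)\<^sup>2)" if z: "Im z \<noteq> 0" for z
  proof -
    obtain S where S: "(\<integral>y. 1 / (z - complex_of_real y) \<partial>measure_pmf p) = exp S / (z - complex_of_real c)"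
      "norm (S - (LINT w:{c..t}|lebesgue. complex_of_real (\<rho> w) / (z - complex_of_real w))) \<le> real n * (2 * \<eta>\<^sup>2 / (Im z)\<^sup>2)"
      using pz[OF z] by blast
    define J where "J a b = (LINT w:{a..b}|lebesgue. complex_of_real (\<rho> w) / (z - complex_of_real w))" for a b
    define T where "T = (LINT w:{t..t + m}|lebesgue. 1 / (z - complex_of_real w))"
    \<comment> \<open>Both \<open>\<kappa>\<close> and \<open>\<rho>\<close> have mass
      \<open>m\<close> on the cell, hence the same frozen term; two applications of the cell error
      give the factor 2.\<close>
    define \<kappa> :: "real \<Rightarrow> real" where "\<kappa> = indicator {t..t + m}"
    have \<kappa>: "\<kappa> \<in> borel_measurable lebesgue" "\<bar>\<kappa> w\<bar> \<le> 1" for w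
      unfolding \<kappa>_def by (auto intro!: borel_measurable_indicator split: split_indicator)
    have ind: "indicator {t..t + \<eta>} w *\<^sub>R (complex_of_real (\<kappa> w) / (z - complex_of_real w))
        = indicator {t..t + m} w *\<^sub>R (1 / (z - complex_of_real w))"
      "indicator {t..t + \<eta>} w *\<^sub>R \<kappa> w = indicator {t..t + m} w" for w
      using m by (auto simp: \<kappa>_def indicator_def)
    have T_eq: "T = (LINT w:{t..t + \<eta>}|lebesgue. complex_of_real (\<kappa> w) / (z - complex_of_real w))"
      unfolding T_def set_lebesgue_integral_def ind ..
    have m_eq: "(LINT w:{t..t + \<eta>}|lebesgue. \<kappa> w) = m"
      unfolding set_lebesgue_integral_def ind using m by simp
    have "norm (T - complex_of_real m / (z - complex_of_real t)) \<le> \<eta>\<^sup>2 / (Im z)\<^sup>2"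
      using density_kernel_cell_error[OF \<kappa> z \<eta>, of t] unfolding T_eq m_eq .
    moreover have "norm (J t (t + \<eta>) - complex_of_real m / (z - complex_of_real t)) \<le> \<eta>\<^sup>2 / (Im z)\<^sup>2"
      using density_kernel_cell_error[OF \<rho>(1) \<rho>_abs z \<eta>, of t] unfolding J_def m_def .
    ultimately have "norm ((T - complex_of_real m / (z - complex_of_real t))
        - (J t (t + \<eta>) - complex_of_real m / (z - complex_of_real t))) \<le> \<eta>\<^sup>2 / (Im z)\<^sup>2 + \<eta>\<^sup>2 / (Im z)\<^sup>2"
      by (rule norm_triangle_le_diff[OF add_mono])
    then have TJ: "norm (T - J t (t + \<eta>)) \<le> 2 * \<eta>\<^sup>2 / (Im z)\<^sup>2"
      by simp
    have "J c (t + \<eta>) = J c t + J t (t + \<eta>)"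
      unfolding J_def using t' \<eta> \<rho>(1) \<rho>_abs z by (intro set_integral_Icc_combine set_integrable_density_kernel) auto
    then have "S + T - J c (t + \<eta>) = (S - J c t) + (T - J t (t + \<eta>))"
      by simp
    also have "norm \<dots> \<le> real n * (2 * \<eta>\<^sup>2 / (Im z)\<^sup>2) + 2 * \<eta>\<^sup>2 / (Im z)\<^sup>2"
      using S(2) TJ unfolding J_def[symmetric] by (intro norm_triangle_mono)
    also have "\<dots> = real (Suc n) * (2 * \<eta>\<^sup>2 / (Im z)\<^sup>2)"
      by (simp add: distrib_right add.commute add_divide_distrib)
    finally have "norm (S + T - J c (t + \<eta>)) \<le> real (Suc n) * (2 * \<eta>\<^sup>2 / (Im z)\<^sup>2)" .
    moreover have "(\<integral>y. 1 / (z - complex_of_real y) \<partial>measure_pmf p') = exp (S + T) / (z - complex_of_real c)"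
      unfolding p'z[OF z] S(1) T_def exp_add using exp_integral_inverse_sub_real[OF z, of t "t + m"] m by simp
    ultimately show ?thesis
      unfolding J_def by blast
  qed
  moreover have "set_pmf p' \<subseteq> {c..t + \<eta>}"
    using p'(2) m by auto
  ultimately show ?case
    unfolding t' using p'(1) by blast
qed

text \<open>With N + 1 cells of length 2 C / (N + 1) the total error is 8 C^2 / ((Im z)^2 (N + 1)).
  All supports lie in [-C, C], so a subsequence converges weakly, and off the real axis 1 / (z - x)
  is bounded and continuous in x, so the transforms converge too.\<close>

theorem exists_measure_of_density:
  fixes \<rho> :: "real \<Rightarrow> real"
  assumes \<rho>: "\<rho> \<in> borel_measurable lebesgue" "\<And>w. 0 \<le> \<rho> w" "\<And>w. \<rho> w \<le> 1" and C: "0 < C"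
  obtains \<mu> :: "real measure" where "prob_space \<mu>" "sets \<mu> = sets borel" "emeasure \<mu> {x. C < \<bar>x\<bar>} = 0"
    "\<And>z. Im z \<noteq> 0 \<Longrightarrow> cauchy_transform \<mu> z
      = exp (LINT w:{-C..C}|lebesgue. complex_of_real (\<rho> w) / (z - complex_of_real w)) / (z + complex_of_real C)"
proof -
  define J where "J z = (LINT w:{-C..C}|lebesgue. complex_of_real (\<rho> w) / (z - complex_of_real w))" for z
  define \<eta> where "\<eta> N = 2 * C / real (Suc N)" for N
  have \<eta>: "0 \<le> \<eta> N" "- C + real (Suc N) * \<eta> N = C" for N
    using C by (auto simp: \<eta>_def simp del: of_nat_Suc)
  have "\<exists>p::real pmf. finite (set_pmf p) \<and> set_pmf p \<subseteq> {-C..C} \<and>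
     (\<forall>z. Im z \<noteq> 0 \<longrightarrow> (\<exists>S. (\<integral>y. 1 / (z - complex_of_real y) \<partial>measure_pmf p) = exp S / (z + complex_of_real C) \<and>
       norm (S - J z) \<le> real (Suc N) * (2 * (\<eta> N)\<^sup>2 / (Im z)\<^sup>2)))" for N
    using pmf_approximates_density[OF \<rho> \<eta>(1)[of N], of "- C" "Suc N"] unfolding \<eta>(2) J_def
    by (simp only: of_real_minus diff_minus_eq_add)
  then obtain p where p: "\<And>N. finite (set_pmf (p N))" "\<And>N. set_pmf (p N) \<subseteq> {-C..C}"
    "\<And>N z. Im z \<noteq> 0 \<Longrightarrow> \<exists>S. (\<integral>y. 1 / (z - complex_of_real y) \<partial>measure_pmf (p N)) = exp S / (z + complex_of_real C) \<and>
       norm (S - J z) \<le> real (Suc N) * (2 * (\<eta> N)\<^sup>2 / (Im z)\<^sup>2)"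
    by metis
  have lim: "(\<lambda>N. \<integral>y. 1 / (z - complex_of_real y) \<partial>measure_pmf (p N)) \<longlonglongrightarrow> exp (J z) / (z + complex_of_real C)"
    if z: "Im z \<noteq> 0" for z
  proof -
    obtain S where S: "\<And>N. (\<integral>y. 1 / (z - complex_of_real y) \<partial>measure_pmf (p N)) = exp (S N) / (z + complex_of_real C)"
      "\<And>N. norm (S N - J z) \<le> real (Suc N) * (2 * (\<eta> N)\<^sup>2 / (Im z)\<^sup>2)"
      using p(3)[OF z] by metis
    have "real (Suc N) * (2 * (\<eta> N)\<^sup>2 / (Im z)\<^sup>2) = (8 * C\<^sup>2 / (Im z)\<^sup>2) * (1 / real (Suc N))" for N
      by (simp add: \<eta>_def power2_eq_square field_simps del: of_nat_Suc)
    moreover have "(\<lambda>N. (8 * C\<^sup>2 / (Im z)\<^sup>2) * (1 / real (Suc N))) \<longlonglongrightarrow> (8 * C\<^sup>2 / (Im z)\<^sup>2) * 0"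
      by (intro tendsto_intros LIMSEQ_Suc[OF lim_1_over_n])
    ultimately have "(\<lambda>N. S N - J z) \<longlonglongrightarrow> 0"
      using S(2) by (intro Lim_null_comparison[of "\<lambda>N. S N - J z" "\<lambda>N. real (Suc N) * (2 * (\<eta> N)\<^sup>2 / (Im z)\<^sup>2)"]) auto
    then have "S \<longlonglongrightarrow> J z"
      by (rule LIM_zero_cancel)
    moreover have "z + complex_of_real C \<noteq> 0"
      using sub_real_nonzero[OF z, of "- C"] by simp
    ultimately show ?thesis
      unfolding S(1) by (intro tendsto_intros)
  qed
  \<comment> \<open>A \<open>pmf\<close> measures every set; weak convergence is about its copy on
    the Borel sets.\<close>
  define \<nu> where "\<nu> N = distr (measure_pmf (p N)) borel (\<lambda>x. x)" for N
  have \<nu>: "real_distribution (\<nu> N)" for N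
    unfolding \<nu>_def by (intro prob_space.real_distribution_distr measure_pmf.prob_space_axioms) simp
  have int_\<nu>: "integral\<^sup>L (\<nu> N) f = (\<integral>y. f y \<partial>measure_pmf (p N))"
    if "f \<in> borel_measurable borel" for N and f :: "real \<Rightarrow> complex"
    unfolding \<nu>_def using that by (subst integral_distr) auto
  have int_\<nu>': "integral\<^sup>L (\<nu> N) f = (\<integral>y. f y \<partial>measure_pmf (p N))"
    if "f \<in> borel_measurable borel" for N and f :: "real \<Rightarrow> real"
    unfolding \<nu>_def using that by (subst integral_distr) auto
  have "tight \<nu>"
    unfolding tight_def
  proof (intro conjI allI impI \<nu>)
    fix e :: real assume "0 < e"
    \<comment> \<open>Tightness uses half-open intervals; the left end moves to -C - 1 to keep a
      possible atom at -C inside.\<close>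
    have "measure (\<nu> N) {- C - 1<..C} = 1" for N
    proof -
      have "measure (\<nu> N) {- C - 1<..C} = measure (measure_pmf (p N)) {- C - 1<..C}"
        unfolding \<nu>_def by (subst measure_distr) auto
      also have "\<dots> = 1"
        using p(2)[of N] by (subst measure_pmf.prob_eq_1) (auto simp: AE_measure_pmf_iff)
      finally show ?thesis .
    qed
    then show "\<exists>a b. a < b \<and> (\<forall>n. 1 - e < measure (\<nu> n) {a<..b})"
      using \<open>0 < e\<close> C by (intro exI[of _ "- C - 1"] exI[of _ C]) auto
  qed
  then obtain r \<mu> where r: "strict_mono (r :: nat \<Rightarrow> nat)" and \<mu>: "real_distribution \<mu>" "weak_conv_m (\<nu> \<circ> r) \<mu>"
    using tight_imp_convergent_subsubsequence[of \<nu> id] by (auto simp: strict_mono_def)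
  interpret \<mu>: real_distribution \<mu> by (rule \<mu>)
  have \<mu>_sets: "sets \<mu> = sets borel" by simp
  have ct: "cauchy_transform \<mu> z = exp (J z) / (z + complex_of_real C)" if z: "Im z \<noteq> 0" for z
  proof -
    have "(\<lambda>n. integral\<^sup>L ((\<nu> \<circ> r) n) (\<lambda>y. 1 / (z - complex_of_real y))) \<longlonglongrightarrow> cauchy_transform \<mu> z"
      unfolding cauchy_transform_def
      by (rule weak_conv_imp_integral_bdd_continuous_conv[OF _ \<mu>(1) \<mu>(2)])
        (use \<nu> isCont_inverse_sub_real[OF z] norm_inverse_sub_real_le[OF z] in auto)
    moreover have "(\<lambda>n. integral\<^sup>L ((\<nu> \<circ> r) n) (\<lambda>y. 1 / (z - complex_of_real y))) \<longlonglongrightarrow> exp (J z) / (z + complex_of_real C)"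
      using LIMSEQ_subseq_LIMSEQ[OF lim[OF z] r] by (simp add: o_def int_\<nu>)
    ultimately show ?thesis
      by (rule LIMSEQ_unique)
  qed
  \<comment> \<open>A bounded continuous function vanishing exactly on [-C, C]: its zero integrals
    pass to the weak limit, which therefore has no mass outside.\<close>
  define f where "f x = min 1 (max 0 (\<bar>x\<bar> - C))" for x :: real
  have f_cont: "isCont f x" for x
    unfolding f_def by (intro continuous_intros)
  have f_bd: "0 \<le> f x" "f x \<le> 1" for x
    unfolding f_def by auto
  have f_meas[measurable]: "f \<in> borel_measurable borel"
    unfolding f_def by measurable
  have "(\<lambda>n. integral\<^sup>L ((\<nu> \<circ> r) n) f) \<longlonglongrightarrow> integral\<^sup>L \<mu> f"
    by (rule weak_conv_imp_integral_bdd_continuous_conv[OF _ \<mu>(1) \<mu>(2), where B = 1])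
      (use \<nu> f_cont f_bd in auto)
  moreover have "integral\<^sup>L ((\<nu> \<circ> r) n) f = 0" for n
  proof -
    have "integral\<^sup>L ((\<nu> \<circ> r) n) f = (\<integral>y. f y \<partial>measure_pmf (p (r n)))"
      by (simp add: int_\<nu>')
    also have "\<dots> = (\<integral>y. 0 \<partial>measure_pmf (p (r n)))"
    proof (intro integral_cong_AE)
      have "f y = 0" if "y \<in> set_pmf (p (r n))" for y
        using subsetD[OF p(2) that] by (simp add: f_def abs_le_iff max_absorb1)
      then show "AE y in measure_pmf (p (r n)). f y = 0"
        by (simp add: AE_measure_pmf_iff)
    qed auto
    finally show ?thesis by simp
  qed
  ultimately have "integral\<^sup>L \<mu> f = 0"
    using LIMSEQ_unique[OF tendsto_const] by fastforce
  moreover have "integrable \<mu> f"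
    by (rule integrable_bounded_prob[OF \<mu>.prob_space_axioms \<mu>_sets f_meas, of 1]) (use f_bd in auto)
  ultimately have "AE x in \<mu>. f x = 0"
    using f_bd by (subst (asm) integral_nonneg_eq_0_iff_AE) auto
  then have ae: "AE x in \<mu>. \<not> C < \<bar>x\<bar>"
    by eventually_elim (auto simp: f_def min_def max_def split: if_splits)
  have "emeasure \<mu> {x. C < \<bar>x\<bar>} = 0"
    using ae by (subst (asm) AE_iff_measurable[of "{x. C < \<bar>x\<bar>}"]) auto
  then show thesis
    using that[OF \<mu>.prob_space_axioms \<mu>_sets] ct unfolding J_def by blast
qed

section \<open>Transition measures of continual diagrams\<close>

text \<open>Right difference quotients at \<open>w\<close> eventually stay in the interval and
  inherit the bound. The local form serves hypothesis (i), which speaks of [a, b] only.\<close>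

lemma deriv_bound_of_lipschitz:
  fixes f :: "real \<Rightarrow> real"
  assumes lip: "\<And>x y. x \<in> {a..b} \<Longrightarrow> y \<in> {a..b} \<Longrightarrow> \<bar>f x - f y\<bar> \<le> L * \<bar>x - y\<bar>"
    and w: "a < w" "w < b" and D: "(f has_real_derivative D) (at w)"
  shows "\<bar>D\<bar> \<le> L"
proof -
  have "(f has_vector_derivative D) (at w)"
    using D by (simp add: has_real_derivative_iff_has_vector_derivative)
  from tendsto_norm[OF has_vector_derivative_difference_quotient[OF this]]
  have lim: "(\<lambda>n. norm (real (Suc n) *\<^sub>R (f (w + 1 / real (Suc n)) - f w))) \<longlonglongrightarrow> \<bar>D\<bar>"
    by simp
  have "(\<lambda>n. w + 1 / real (Suc n)) \<longlonglongrightarrow> w + 0"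
    by (intro tendsto_intros LIMSEQ_Suc[OF lim_1_over_n])
  then have "\<forall>\<^sub>F n in sequentially. w + 1 / real (Suc n) < b"
    using w by (intro order_tendstoD(2)) auto
  then have "\<forall>\<^sub>F n in sequentially. norm (real (Suc n) *\<^sub>R (f (w + 1 / real (Suc n)) - f w)) \<le> L"
  proof eventually_elim
    case (elim n)
    have "a \<le> w + 1 / real (Suc n)"
      using w by (simp add: add_increasing2)
    then have "\<bar>f (w + 1 / real (Suc n)) - f w\<bar> \<le> L * \<bar>w + 1 / real (Suc n) - w\<bar>"
      using w elim by (intro lip) auto
    then have "real (Suc n) * \<bar>f (w + 1 / real (Suc n)) - f w\<bar> \<le> real (Suc n) * (L * (1 / real (Suc n)))"
      by (intro mult_left_mono) auto
    then show ?case
      by (simp add: abs_mult del: of_nat_Suc)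
  qed
  then show ?thesis
    by (rule tendsto_upperbound[OF lim]) simp
qed

lemma AE_lebesgue_neq: "AE w in lebesgue. w \<noteq> (c::real)"
  by (rule AE_I'[of "{c}"]) (auto simp: negligible_iff_null_sets[symmetric])

lemma integral_poisson_kernel:
  fixes v :: real
  assumes v: "0 < v" and "l \<le> r"
  shows "(LINT w:{l..r}|lebesgue. v / ((s - w)\<^sup>2 + v\<^sup>2)) = arctan ((r - s) / v) - arctan ((l - s) / v)"
    and "set_integrable lebesgue {l..r} (\<lambda>w. v / ((s - w)\<^sup>2 + v\<^sup>2))"
proof -
  have nz: "(s - w)\<^sup>2 + v\<^sup>2 > 0" for w
    using v by (simp add: add_nonneg_pos)
  have "(LINT w:{l..r}|lebesgue. v / ((s - w)\<^sup>2 + v\<^sup>2))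
      = (\<integral>w. indicator {l..r} w *\<^sub>R (v / ((s - w)\<^sup>2 + v\<^sup>2)) \<partial>lborel)"
    unfolding set_lebesgue_integral_def by (rule integral_completion) measurable
  also have "\<dots> = arctan ((r - s) / v) - arctan ((l - s) / v)"
  proof (rule integral_FTC_atLeastAtMost[OF \<open>l \<le> r\<close>])
    fix w :: real
    have "((\<lambda>w. arctan ((w - s) / v)) has_real_derivative inverse (1 + ((w - s) / v)\<^sup>2) * (1 / v)) (at w)"
      using v by (auto intro!: derivative_eq_intros)
    moreover have "inverse (1 + ((w - s) / v)\<^sup>2) * (1 / v) = v / ((s - w)\<^sup>2 + v\<^sup>2)"
    proof -
      have "1 + ((w - s) / v)\<^sup>2 = ((s - w)\<^sup>2 + v\<^sup>2) / v\<^sup>2"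
        using v by (simp add: power_divide power2_commute field_simps)
      then show ?thesis
        using v by (simp add: power2_eq_square)
    qed
    ultimately show "((\<lambda>w. arctan ((w - s) / v)) has_vector_derivative v / ((s - w)\<^sup>2 + v\<^sup>2)) (at w within {l..r})"
      by (auto simp: has_real_derivative_iff_has_vector_derivative intro: has_vector_derivative_at_within)
    show "continuous_on {l..r} (\<lambda>w. v / ((s - w)\<^sup>2 + v\<^sup>2))"
      using nz by (intro continuous_intros) (metis less_irrefl)
  qed
  finally show "(LINT w:{l..r}|lebesgue. v / ((s - w)\<^sup>2 + v\<^sup>2)) = arctan ((r - s) / v) - arctan ((l - s) / v)" .
  show "set_integrable lebesgue {l..r} (\<lambda>w. v / ((s - w)\<^sup>2 + v\<^sup>2))"
  proof (rule set_integrable_lebesgue_Icc_bounded)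
    show "(\<lambda>w. v / ((s - w)\<^sup>2 + v\<^sup>2)) \<in> borel_measurable lebesgue"
      by (rule measurable_completion) measurable
    show "norm (v / ((s - w)\<^sup>2 + v\<^sup>2)) \<le> v / v\<^sup>2" for w
      using v nz[of w] by (auto intro!: divide_left_mono)
  qed
qed

text \<open>The truncation to \<open>[0, 1]\<close> only affects the null set where \<open>\<omega>\<close> is not differentiable and
  \<^const>\<open>deriv\<close> is unspecified.\<close>

definition falling_density :: "(real \<Rightarrow> real) \<Rightarrow> real \<Rightarrow> real" where
  "falling_density \<omega> w = max 0 (min 1 ((1 - deriv \<omega> w) / 2))"

text \<open>A logarithm of (z + C) G(z) once \<open>\<omega> w = \<bar>w\<bar>\<close> for |w| \<ge>
  C. Using z + C instead of z turns the derivative of \<open>diag_sigma\<close>, whose sign changes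
  at 0, into a density in [0, 1].\<close>

definition falling_potential :: "(real \<Rightarrow> real) \<Rightarrow> real \<Rightarrow> complex \<Rightarrow> complex" where
  "falling_potential \<omega> C z =
     (LINT w:{-C..C}|lebesgue. complex_of_real (falling_density \<omega> w) / (z - complex_of_real w))"

lemma falling_density_bounds: "0 \<le> falling_density \<omega> w" "falling_density \<omega> w \<le> 1"
  by (auto simp: falling_density_def)

lemma abs_falling_density_le: "\<bar>falling_density \<omega> w\<bar> \<le> 1"
  using falling_density_bounds[of \<omega> w] by simp

section \<open>Regularity of diagrams, existence and uniqueness of the transition measure\<close>

lemma continual_diagram_lipschitz:
  "continual_diagram \<omega> \<Longrightarrow> \<bar>\<omega> x - \<omega> y\<bar> \<le> 1 * \<bar>x - y\<bar>"
  by (simp add: continual_diagram_def)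

lemma continual_diagram_support:
  assumes "continual_diagram \<omega>"
  obtains C0 where "\<And>C w. C0 \<le> C \<Longrightarrow> C \<le> \<bar>w\<bar> \<Longrightarrow> \<omega> w = \<bar>w\<bar>"
  using assms unfolding continual_diagram_def by (meson order_trans)

text \<open>At unit slope a diagram cannot fall below |z| on the way in from C and -C, where its
  value is C. This makes (\<omega>(z) + z) / 2 and (\<omega>(z) - z) / 2 nonnegative coordinates, as
  the metric requires.\<close>

lemma continual_diagram_ge_abs:
  assumes "continual_diagram \<omega>"
  shows "\<bar>z\<bar> \<le> \<omega> z"
proof -
  obtain C0 where C0: "\<And>C w. C0 \<le> C \<Longrightarrow> C \<le> \<bar>w\<bar> \<Longrightarrow> \<omega> w = \<bar>w\<bar>"
    using continual_diagram_support[OF assms] by blast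
  define C where "C = max \<bar>C0\<bar> \<bar>z\<bar>"
  have "\<omega> C = C" "\<omega> (- C) = C"
    using C0[of C C] C0[of C "- C"] unfolding C_def by auto
  moreover have "\<bar>z\<bar> \<le> C"
    unfolding C_def by simp
  ultimately show ?thesis
    using continual_diagram_lipschitz[OF assms, of C z] continual_diagram_lipschitz[OF assms, of "- C" z]
    unfolding mult_1 by linarith
qed

lemma AE_lipschitz_has_deriv:
  fixes f :: "real \<Rightarrow> real"
  assumes "\<And>x y. \<bar>f x - f y\<bar> \<le> L * \<bar>x - y\<bar>"
  shows "AE w in lebesgue. (f has_real_derivative deriv f w) (at w)"
  using lipschitz_AE_differentiable[OF assms]
  by eventually_elim (metis DERIV_deriv_iff_real_differentiable)

lemma AE_continual_diagram:
  assumes "continual_diagram \<omega>"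
  shows "AE w in lebesgue. (\<omega> has_real_derivative deriv \<omega> w) (at w) \<and> \<bar>deriv \<omega> w\<bar> \<le> 1
    \<and> falling_density \<omega> w = (1 - deriv \<omega> w) / 2"
  using AE_lipschitz_has_deriv[OF continual_diagram_lipschitz[OF assms]]
proof eventually_elim
  case (elim w)
  have "\<bar>deriv \<omega> w\<bar> \<le> 1"
    by (rule deriv_bound_of_lipschitz[of "w - 1" "w + 1" \<omega>, OF continual_diagram_lipschitz[OF assms] _ _ elim]) auto
  then show ?case
    using elim by (simp add: falling_density_def)
qed

lemma measurable_falling_density:
  assumes "continual_diagram \<omega>"
  shows "falling_density \<omega> \<in> borel_measurable lebesgue"
proof -
  have "AE w in lebesgue. (\<omega> has_vector_derivative deriv \<omega> w) (at w)"
    using AE_continual_diagram[OF assms]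
    by eventually_elim (simp add: has_real_derivative_iff_has_vector_derivative)
  then have "deriv \<omega> \<in> borel_measurable lebesgue"
    using lipschitz_FTC(1)[of \<omega> 1 "deriv \<omega>" 0 0] continual_diagram_lipschitz[OF assms] by simp
  then show ?thesis
    unfolding falling_density_def by measurable
qed

lemma set_integrable_falling_kernel:
  assumes "continual_diagram \<omega>" "Im z \<noteq> 0"
  shows "set_integrable lebesgue {a..b} (\<lambda>w. complex_of_real (falling_density \<omega> w) / (z - complex_of_real w))"
  using assms abs_falling_density_le
  by (intro set_integrable_density_kernel[of _ 1] measurable_falling_density) auto

text \<open>Almost everywhere the derivative of \<open>diag_sigma \<omega>\<close> is the indicator
  of [-C, 0] minus the falling density on [-C, C], and 0 outside. The integral of the kernel over
  [-C, 0] exponentiates to (z + C) / z.\<close>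

lemma exp_diag_sigma_potential:
  assumes \<omega>: "continual_diagram \<omega>" and z: "Im z \<noteq> 0"
    and C: "0 < C" "\<And>w. C \<le> \<bar>w\<bar> \<Longrightarrow> \<omega> w = \<bar>w\<bar>"
  shows "exp (- (\<integral>w. complex_of_real (deriv (diag_sigma \<omega>) w) / (z - complex_of_real w) \<partial>lebesgue))
    = z * (exp (falling_potential \<omega> C z) / (z + complex_of_real C))"
proof -
  define k where "k w = 1 / (z - complex_of_real w)" for w
  define F where "F w = indicator {-C..0} w *\<^sub>R k w
    - indicator {-C..C} w *\<^sub>R (complex_of_real (falling_density \<omega> w) / (z - complex_of_real w))" for w
  have i1: "set_integrable lebesgue {-C..0} k"
    unfolding k_def
    by (rule set_integrable_lebesgue_Icc_bounded[OF measurable_lebesgue_inverse_sub_real norm_inverse_sub_real_le[OF z]])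
  have i2: "set_integrable lebesgue {-C..C} (\<lambda>w. complex_of_real (falling_density \<omega> w) / (z - complex_of_real w))"
    by (rule set_integrable_falling_kernel[OF \<omega> z])
  have F_int: "integrable lebesgue F"
    unfolding F_def using i1 i2 by (intro Bochner_Integration.integrable_diff) (auto simp: set_integrable_def)
  \<comment> \<open>The three excluded points are the kink of |w| at 0 and the ends of the window,
    where the case split on |w| < C would not be an open condition.\<close>
  have "AE w in lebesgue. F w = complex_of_real (deriv (diag_sigma \<omega>) w) / (z - complex_of_real w)"
    using AE_continual_diagram[OF \<omega>] AE_lebesgue_neq[of 0] AE_lebesgue_neq[of C] AE_lebesgue_neq[of "- C"]
  proof eventually_elim
    case (elim w)
    define D where "D = deriv \<omega> w"
    have D: "(\<omega> has_real_derivative D) (at w)" "falling_density \<omega> w = (1 - D) / 2"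
      using elim unfolding D_def by auto
    have abs_der: "((\<lambda>x. \<bar>x\<bar>) has_real_derivative sgn w) (at w)"
    proof (rule has_field_derivative_transform_within_open)
      show "((\<lambda>x. sgn w * x) has_real_derivative sgn w) (at w)"
        by (auto intro!: derivative_eq_intros)
      show "open (if 0 < w then {0::real<..} else {..<0})" "w \<in> (if 0 < w then {0<..} else {..<0})"
        using elim by auto
      show "sgn w * x = \<bar>x\<bar>" if "x \<in> (if 0 < w then {0<..} else {..<0})" for x
        using that elim by (auto simp: sgn_if split: if_splits)
    qed
    have "(diag_sigma \<omega> has_real_derivative (D - sgn w) / 2) (at w)"
      unfolding diag_sigma_def[abs_def] by (intro DERIV_cdivide DERIV_diff D abs_der)
    then have der: "deriv (diag_sigma \<omega>) w = (D - sgn w) / 2"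
      by (rule DERIV_imp_deriv)
    show ?case
    proof (cases "\<bar>w\<bar> < C")
      case True
      then have mem: "w \<in> {-C..C}" "w \<in> {-C..0} \<longleftrightarrow> w < 0"
        using elim by auto
      have fk: "complex_of_real x / (z - complex_of_real w) = complex_of_real x * k w" for x
        by (simp add: k_def)
      have "F w = complex_of_real ((if w < 0 then 1 else 0) - (1 - D) / 2) * k w"
        unfolding F_def D(2) fk of_real_diff left_diff_distrib using mem by auto
      also have "(if w < 0 then 1 else 0) - (1 - D) / 2 = (D - sgn w) / 2"
        using elim by (auto simp: sgn_if field_simps)
      finally show ?thesis
        unfolding der k_def by simp
    next
      case False
      then have w: "C < \<bar>w\<bar>"
        using elim by auto
      then have "w \<notin> {-C..C}" "w \<notin> {-C..0}"
        using C by auto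
      then have "F w = 0"
        unfolding F_def by simp
      \<comment> \<open>C < |w| is an open condition, so the diagram agrees with the absolute value
        near \<open>w\<close> and so do the derivatives.\<close>
      moreover have "D = sgn w"
      proof (rule DERIV_unique[OF _ abs_der])
        have "open {x::real. C < \<bar>x\<bar>}"
          by (intro open_Collect_less continuous_intros)
        then show "((\<lambda>x. \<bar>x\<bar>) has_real_derivative D) (at w)"
          by (rule has_field_derivative_transform_within_open[OF D(1)]) (use w C(2) in auto)
      qed
      ultimately show ?thesis
        unfolding der by simp
    qed
  qed
  moreover from this have "(\<lambda>w. complex_of_real (deriv (diag_sigma \<omega>) w) / (z - complex_of_real w)) \<in> borel_measurable lebesgue"
    by (rule borel_measurable_AE[OF borel_measurable_integrable[OF F_int]])
  ultimately have "(\<integral>w. complex_of_real (deriv (diag_sigma \<omega>) w) / (z - complex_of_real w) \<partial>lebesgue) = (\<integral>w. F w \<partial>lebesgue)"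
    using borel_measurable_integrable[OF F_int] by (intro integral_cong_AE) auto
  also have "\<dots> = (LINT w:{-C..0}|lebesgue. k w) - falling_potential \<omega> C z"
    unfolding F_def falling_potential_def set_lebesgue_integral_def
    using i1 i2 by (intro Bochner_Integration.integral_diff) (auto simp: set_integrable_def)
  finally have "exp (- (\<integral>w. complex_of_real (deriv (diag_sigma \<omega>) w) / (z - complex_of_real w) \<partial>lebesgue))
      = exp (falling_potential \<omega> C z) / exp (LINT w:{-C..0}|lebesgue. k w)"
    by (simp add: exp_diff)
  also have "exp (LINT w:{-C..0}|lebesgue. k w) = (z + complex_of_real C) / z"
    unfolding k_def using exp_integral_inverse_sub_real[OF z, of "- C" 0] C by simp
  finally show ?thesis
    by simp
qed

text \<open>This makes the definite description usable: existence comes from the falling density,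
  uniqueness from the Cauchy transform on the upper half-plane.\<close>

theorem is_transition_measure_transition_measure:
  assumes \<omega>: "continual_diagram \<omega>"
  shows "is_transition_measure \<omega> (transition_measure \<omega>)"
  unfolding transition_measure_def
proof (rule theI')
  obtain C0 where C0: "\<And>C w. C0 \<le> C \<Longrightarrow> C \<le> \<bar>w\<bar> \<Longrightarrow> \<omega> w = \<bar>w\<bar>"
    using continual_diagram_support[OF \<omega>] by blast
  define C where "C = \<bar>C0\<bar> + 1"
  have C: "0 < C" "\<And>w. C \<le> \<bar>w\<bar> \<Longrightarrow> \<omega> w = \<bar>w\<bar>"
    using C0[of C] by (auto simp: C_def)
  obtain \<mu> where \<mu>: "prob_space \<mu>" "sets \<mu> = sets borel" "emeasure \<mu> {x. C < \<bar>x\<bar>} = 0"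
    "\<And>z. Im z \<noteq> 0 \<Longrightarrow> cauchy_transform \<mu> z = exp (falling_potential \<omega> C z) / (z + complex_of_real C)"
    unfolding falling_potential_def
    using exists_measure_of_density[OF measurable_falling_density[OF \<omega>] falling_density_bounds C(1)] by blast
  show "\<exists>!\<mu>. is_transition_measure \<omega> \<mu>"
  proof (rule ex1I[of _ \<mu>])
    show "is_transition_measure \<omega> \<mu>"
      unfolding is_transition_measure_def using \<mu> exp_diag_sigma_potential[OF \<omega> _ C] by auto
    fix \<nu> assume \<nu>: "is_transition_measure \<omega> \<nu>"
    show "\<nu> = \<mu>"
    proof (rule cauchy_transform_inject)
      fix z :: complex assume z: "0 < Im z"
      then have "z * cauchy_transform \<nu> z = z * cauchy_transform \<mu> z"
        using \<nu> \<mu>(4)[of z] exp_diag_sigma_potential[OF \<omega> _ C, of z] unfolding is_transition_measure_def by auto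
      then show "cauchy_transform \<nu> z = cauchy_transform \<mu> z"
        using z by auto
    qed (use \<nu> \<mu> in \<open>auto simp: is_transition_measure_def\<close>)
  qed
qed

lemma transition_measure_prob:
  assumes "continual_diagram \<omega>"
  shows "prob_space (transition_measure \<omega>)" "sets (transition_measure \<omega>) = sets borel"
  using is_transition_measure_transition_measure[OF assms] by (auto simp: is_transition_measure_def)

lemma cauchy_transform_transition_measure:
  assumes \<omega>: "continual_diagram \<omega>" and z: "Im z \<noteq> 0"
    and C: "0 < C" "\<And>w. C \<le> \<bar>w\<bar> \<Longrightarrow> \<omega> w = \<bar>w\<bar>"
  shows "cauchy_transform (transition_measure \<omega>) z = exp (falling_potential \<omega> C z) / (z + complex_of_real C)"
proof -
  have "z * cauchy_transform (transition_measure \<omega>) z = z * (exp (falling_potential \<omega> C z) / (z + complex_of_real C))"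
    using is_transition_measure_transition_measure[OF \<omega>] exp_diag_sigma_potential[OF \<omega> z C] z
    unfolding is_transition_measure_def by auto
  moreover have "z \<noteq> 0"
    using z by auto
  ultimately show ?thesis
    by (metis mult_left_cancel)
qed

section \<open>Cauchy transforms near the real axis\<close>

text \<open>\<Delta> is the difference of the two potentials. Almost everywhere D = (\<Omega> -
  \<omega>) / 2 has the difference of the falling densities as derivative, so integration by parts
  gives \<Delta> = - \<integral> D k^2. Here |D| \<le> e, and |k|^2 is 1 / v times the Poisson
  kernel, of mass at most pi.\<close>

lemma cauchy_transform_ratio:
  assumes \<Omega>: "continual_diagram \<Omega>" and \<omega>: "continual_diagram \<omega>"
    and close: "\<And>w. \<bar>\<Omega> w - \<omega> w\<bar> \<le> 2 * e" and v: "0 < v"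
  obtains \<Delta> where "norm \<Delta> \<le> pi * e / v"
    "cauchy_transform (transition_measure \<omega>) (Complex s v)
      = cauchy_transform (transition_measure \<Omega>) (Complex s v) * exp \<Delta>"
proof -
  define z where "z = Complex s v"
  have z: "Im z \<noteq> 0" "\<bar>Im z\<bar> = v"
    using v by (auto simp: z_def)
  obtain C1 where C1: "\<And>C w. C1 \<le> C \<Longrightarrow> C \<le> \<bar>w\<bar> \<Longrightarrow> \<Omega> w = \<bar>w\<bar>"
    using continual_diagram_support[OF \<Omega>] by blast
  obtain C2 where C2: "\<And>C w. C2 \<le> C \<Longrightarrow> C \<le> \<bar>w\<bar> \<Longrightarrow> \<omega> w = \<bar>w\<bar>"
    using continual_diagram_support[OF \<omega>] by blast
  \<comment> \<open>One \<open>C\<close> for both diagrams makes the factors z + C cancel in the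
    ratio.\<close>
  define C where "C = \<bar>C1\<bar> + \<bar>C2\<bar> + 1"
  have C: "0 < C" "\<And>w. C \<le> \<bar>w\<bar> \<Longrightarrow> \<Omega> w = \<bar>w\<bar>" "\<And>w. C \<le> \<bar>w\<bar> \<Longrightarrow> \<omega> w = \<bar>w\<bar>"
    using C1[of C] C2[of C] by (auto simp: C_def)
  define k where "k w = 1 / (z - complex_of_real w)" for w
  define D where "D w = (\<Omega> w - \<omega> w) / 2" for w
  define f where "f w = complex_of_real (D w) * k w" for w
  define g where "g w = complex_of_real (falling_density \<omega> w - falling_density \<Omega> w) / (z - complex_of_real w)" for w
  define q where "q w = complex_of_real (D w) * (k w)\<^sup>2" for w
  have e0: "0 \<le> e"
    using close[of 0] by simp
  have D_bd: "\<bar>D w\<bar> \<le> e" for w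
    using close[of w] by (simp add: D_def)
  have D_lip: "\<bar>D x - D y\<bar> \<le> \<bar>x - y\<bar>" for x y
    using continual_diagram_lipschitz[OF \<Omega>, of x y] continual_diagram_lipschitz[OF \<omega>, of x y]
    unfolding D_def mult_1 by (simp add: abs_le_iff field_simps)
  have k_bd: "norm (k w) \<le> 1 / v" for w
    unfolding k_def using norm_inverse_sub_real_le[OF z(1), of w] z(2) by simp
  have k_diff: "k x - k y = complex_of_real (x - y) * (k x * k y)" for x y
    unfolding k_def using sub_real_nonzero[OF z(1)] by (simp add: field_simps)
  \<comment> \<open>Integration by parts is \<open>lipschitz_FTC\<close> applied to the product
    \<open>f\<close> of \<open>D\<close> and \<open>k\<close>, which requires a global Lipschitz
    constant.\<close>
  have f_lip: "norm (f x - f y) \<le> (1 / v + e / v\<^sup>2) * \<bar>x - y\<bar>" for x y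
  proof -
    have "f x - f y = complex_of_real (D x - D y) * k x + complex_of_real (D y) * (k x - k y)"
      by (simp add: f_def algebra_simps)
    also have "norm \<dots> \<le> \<bar>x - y\<bar> * (1 / v) + e * (\<bar>x - y\<bar> * (1 / v * (1 / v)))"
      unfolding k_diff
      by (rule norm_triangle_mono; unfold norm_mult norm_of_real; intro mult_mono D_lip D_bd k_bd order_refl)
        (use e0 v in auto)
    finally show ?thesis
      by (simp add: algebra_simps power2_eq_square)
  qed
  have k_der: "(k has_vector_derivative (k w)\<^sup>2) (at w)" for w
  proof -
    have "((\<lambda>u. 1 / (z - u)) has_field_derivative (k w)\<^sup>2) (at (complex_of_real w))"
      unfolding k_def using sub_real_nonzero[OF z(1), of w]
      by (auto intro!: derivative_eq_intros simp: power2_eq_square)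
    then show ?thesis
      unfolding k_def by (rule has_vector_derivative_real_field)
  qed
  have "AE w in lebesgue. (f has_vector_derivative g w + q w) (at w)"
    using AE_continual_diagram[OF \<Omega>] AE_continual_diagram[OF \<omega>]
  proof eventually_elim
    case (elim w)
    have "(D has_real_derivative (deriv \<Omega> w - deriv \<omega> w) / 2) (at w)"
      unfolding D_def using elim by (intro DERIV_cdivide DERIV_diff) auto
    also have "(deriv \<Omega> w - deriv \<omega> w) / 2 = falling_density \<omega> w - falling_density \<Omega> w"
      using elim by (simp add: field_simps)
    finally have "((\<lambda>w. complex_of_real (D w)) has_vector_derivative
        complex_of_real (falling_density \<omega> w - falling_density \<Omega> w)) (at w)"
      by (intro has_vector_derivative_of_real) (simp add: has_real_derivative_iff_has_vector_derivative)
    from has_vector_derivative_mult[OF this k_der[of w]]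
    have "(f has_vector_derivative complex_of_real (D w) * (k w)\<^sup>2
        + complex_of_real (falling_density \<omega> w - falling_density \<Omega> w) * k w) (at w)"
      unfolding f_def .
    moreover have "complex_of_real (D w) * (k w)\<^sup>2 + complex_of_real (falling_density \<omega> w - falling_density \<Omega> w) * k w = g w + q w"
      by (simp add: g_def q_def k_def)
    ultimately show ?case
      by simp
  qed
  \<comment> \<open>The boundary terms vanish because both diagrams equal |w| at -C and C.\<close>
  from lipschitz_FTC(3)[OF f_lip this, of "- C" C]
  have FTC: "(LINT w:{-C..C}|lebesgue. g w + q w) = 0"
    using C by (simp add: f_def D_def)
  have g_split: "g w = complex_of_real (falling_density \<omega> w) / (z - complex_of_real w)
      - complex_of_real (falling_density \<Omega> w) / (z - complex_of_real w)" for w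
    by (simp add: g_def diff_divide_distrib)
  note i\<omega> = set_integrable_falling_kernel[OF \<omega> z(1), of "- C" C]
  note i\<Omega> = set_integrable_falling_kernel[OF \<Omega> z(1), of "- C" C]
  have i_g: "set_integrable lebesgue {-C..C} g"
    unfolding g_split by (rule set_integral_diff(1)[OF i\<omega> i\<Omega>])
  have g_eq: "(LINT w:{-C..C}|lebesgue. g w) = falling_potential \<omega> C z - falling_potential \<Omega> C z"
    unfolding g_split falling_potential_def by (rule set_integral_diff(2)[OF i\<omega> i\<Omega>])
  have q_bd: "norm (q w) \<le> e / v * (v / ((s - w)\<^sup>2 + v\<^sup>2))" for w
  proof -
    have "norm ((k w)\<^sup>2) = 1 / ((s - w)\<^sup>2 + v\<^sup>2)"
      by (simp add: k_def z_def norm_power norm_divide power_divide cmod_power2)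
    then have "norm (q w) = \<bar>D w\<bar> * (1 / ((s - w)\<^sup>2 + v\<^sup>2))"
      by (simp add: q_def norm_mult)
    also have "\<dots> \<le> e * (1 / ((s - w)\<^sup>2 + v\<^sup>2))"
      using D_bd by (intro mult_right_mono) auto
    finally show ?thesis
      using v by simp
  qed
  have q_meas: "q \<in> borel_measurable lebesgue"
  proof -
    have "continuous_on UNIV \<Omega>" "continuous_on UNIV \<omega>"
      using continual_diagram_lipschitz[OF \<Omega>] continual_diagram_lipschitz[OF \<omega>]
      by (auto intro!: lipschitz_on_continuous_on[of 1] simp: lipschitz_on_def dist_real_def)
    then have "continuous_on UNIV q"
      unfolding q_def D_def k_def using sub_real_nonzero[OF z(1)] by (intro continuous_intros) auto
    then show ?thesis
      by (intro measurable_completion) (simp add: borel_measurable_continuous_onI)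
  qed
  have "norm (q w) \<le> e / v * (v / v\<^sup>2)" for w
  proof -
    have "v / ((s - w)\<^sup>2 + v\<^sup>2) \<le> v / v\<^sup>2"
      using v by (intro divide_left_mono) (auto intro!: mult_pos_pos add_nonneg_pos)
    then show ?thesis
      using e0 v by (intro order_trans[OF q_bd] mult_left_mono) auto
  qed
  then have i_q: "set_integrable lebesgue {-C..C} q"
    by (rule set_integrable_lebesgue_Icc_bounded[OF q_meas])
  note iP = integral_poisson_kernel[OF v, of "- C" C s]
  have "norm (LINT w:{-C..C}|lebesgue. q w) \<le> (LINT w:{-C..C}|lebesgue. norm (q w))"
    by (rule set_integral_norm_bound[OF i_q])
  also have "\<dots> \<le> (LINT w:{-C..C}|lebesgue. e / v * (v / ((s - w)\<^sup>2 + v\<^sup>2)))"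
    using q_bd iP(2) C by (intro set_integral_mono set_integrable_norm i_q set_integrable_mult_right) auto
  also have "\<dots> = e / v * (arctan ((C - s) / v) - arctan ((- C - s) / v))"
    using iP C by (subst set_integral_mult_right) auto
  also have "\<dots> \<le> e / v * pi"
    using abs_arctan_le_half_pi[of "(C - s) / v"] abs_arctan_le_half_pi[of "(- C - s) / v"] e0 v
    by (intro mult_left_mono) (auto simp: abs_le_iff)
  finally have q_int: "norm (LINT w:{-C..C}|lebesgue. q w) \<le> pi * e / v"
    by (simp add: mult.commute)
  have "falling_potential \<omega> C z - falling_potential \<Omega> C z = - (LINT w:{-C..C}|lebesgue. q w)"
    using FTC unfolding set_integral_add(2)[OF i_g i_q] g_eq by (simp add: eq_neg_iff_add_eq_0)
  then have "norm (falling_potential \<omega> C z - falling_potential \<Omega> C z) \<le> pi * e / v"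
    using q_int by simp
  moreover have "cauchy_transform (transition_measure \<omega>) z
      = cauchy_transform (transition_measure \<Omega>) z * exp (falling_potential \<omega> C z - falling_potential \<Omega> C z)"
  proof -
    have "cauchy_transform (transition_measure \<omega>) z = exp (falling_potential \<omega> C z) / (z + complex_of_real C)"
      using cauchy_transform_transition_measure[OF \<omega> z(1) C(1,3)] by simp
    moreover have "cauchy_transform (transition_measure \<Omega>) z = exp (falling_potential \<Omega> C z) / (z + complex_of_real C)"
      using cauchy_transform_transition_measure[OF \<Omega> z(1) C(1,2)] by simp
    ultimately show ?thesis
      by (simp add: exp_diff)
  qed
  ultimately show thesis
    using that unfolding z_def by blast
qed

lemma sin_ge_sin_of_mem:
  assumes "0 \<le> \<theta>" "\<theta> \<le> x" "x \<le> pi - \<theta>"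
  shows "sin \<theta> \<le> sin x"
proof (cases "x \<le> pi / 2")
  case True
  then show ?thesis
    using assms by (intro sin_monotone_2pi_le) auto
next
  case False
  then have "sin \<theta> \<le> sin (pi - x)"
    using assms by (intro sin_monotone_2pi_le) auto
  then show ?thesis by simp
qed

text \<open>In polar form G = |G| exp (- i \<phi>) with \<phi> = I + \<beta>, hence - Im G = |G| sin
  \<phi>. Here I is the Poisson integral of the falling density and \<beta> the argument of z + C.
  On [a, b] the density lies between \<delta> / 2 and 1 - \<delta> / 2, which keeps \<phi> at
  distance at least \<delta> arctan c from 0 and pi. The other two conclusions make the sine of that
  angle positive.\<close>

lemma norm_cauchy_transform_le_Im:
  assumes \<Omega>: "continual_diagram \<Omega>"
    and lip: "\<And>x y. x \<in> {a..b} \<Longrightarrow> y \<in> {a..b} \<Longrightarrow> \<bar>\<Omega> x - \<Omega> y\<bar> \<le> (1 - \<delta>) * \<bar>x - y\<bar>"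
    and \<delta>: "0 < \<delta>" and c: "0 < c" "a + c \<le> s" "s + c \<le> b" and v: "0 < v" "v \<le> 1"
  shows "norm (cauchy_transform (transition_measure \<Omega>) (Complex s v)) * sin (\<delta> * arctan c)
      \<le> - Im (cauchy_transform (transition_measure \<Omega>) (Complex s v))"
    and "0 < \<delta> * arctan c" "\<delta> * arctan c \<le> pi / 2"
proof -
  define z where "z = Complex s v"
  have z: "Im z \<noteq> 0" "0 < Im z"
    using v by (auto simp: z_def)
  obtain C0 where C0: "\<And>C w. C0 \<le> C \<Longrightarrow> C \<le> \<bar>w\<bar> \<Longrightarrow> \<Omega> w = \<bar>w\<bar>"
    using continual_diagram_support[OF \<Omega>] by blast
  define C where "C = \<bar>C0\<bar> + \<bar>a\<bar> + \<bar>b\<bar> + 1"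
  have C: "0 < C" "\<And>w. C \<le> \<bar>w\<bar> \<Longrightarrow> \<Omega> w = \<bar>w\<bar>" and abC: "- C \<le> a" "b \<le> C" "a < b"
    using C0[of C] c by (auto simp: C_def)
  define P where "P w = v / ((s - w)\<^sup>2 + v\<^sup>2)" for w
  define \<rho> where "\<rho> = falling_density \<Omega>"
  have P0: "0 \<le> P w" for w
    using v by (simp add: P_def)
  note pk = integral_poisson_kernel[OF v(1), of _ _ s, folded P_def]
  define I where "I = (LINT w:{-C..C}|lebesgue. \<rho> w * P w)"
  define \<theta> where "\<theta> = \<delta> * arctan c"
  have iP: "set_integrable lebesgue {-C..C} P" "set_integrable lebesgue {a..b} P"
    using pk(2) C abC by auto
  have i\<rho>: "set_integrable lebesgue {-C..C} (\<lambda>w. \<rho> w * P w)"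
    unfolding set_integrable_def
  proof (rule Bochner_Integration.integrable_bound)
    show "integrable lebesgue (\<lambda>w. indicator {-C..C} w *\<^sub>R P w)"
      using iP(1) unfolding set_integrable_def .
    have "(\<lambda>w. \<rho> w * (indicator {-C..C} w *\<^sub>R P w)) \<in> borel_measurable lebesgue"
      unfolding \<rho>_def
      by (intro borel_measurable_times measurable_falling_density[OF \<Omega>] borel_measurable_integrable
          iP(1)[unfolded set_integrable_def])
    then show "(\<lambda>w. indicator {-C..C} w *\<^sub>R (\<rho> w * P w)) \<in> borel_measurable lebesgue"
      by (simp add: mult_ac)
    have "\<bar>\<rho> w\<bar> * \<bar>P w\<bar> \<le> 1 * \<bar>P w\<bar>" for w
      unfolding \<rho>_def using abs_falling_density_le by (intro mult_right_mono) auto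
    then show "AE w in lebesgue. norm (indicator {-C..C} w *\<^sub>R (\<rho> w * P w)) \<le> norm (indicator {-C..C} w *\<^sub>R P w)"
      by (auto simp: indicator_def abs_mult)
  qed
  have "Im (falling_potential \<Omega> C z)
      = (\<integral>w. Im (indicator {-C..C} w *\<^sub>R (complex_of_real (falling_density \<Omega> w) / (z - complex_of_real w))) \<partial>lebesgue)"
    unfolding falling_potential_def set_lebesgue_integral_def
    by (rule integral_Im[symmetric]) (use set_integrable_falling_kernel[OF \<Omega> z(1)] in \<open>simp add: set_integrable_def\<close>)
  also have "\<dots> = (\<integral>w. - (indicator {-C..C} w *\<^sub>R (\<rho> w * P w)) \<partial>lebesgue)"
  proof (intro Bochner_Integration.integral_cong refl)
    fix w
    have "complex_of_real (falling_density \<Omega> w) / (z - complex_of_real w)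
        = falling_density \<Omega> w *\<^sub>R (1 / (z - complex_of_real w))"
      by (simp add: scaleR_conv_of_real)
    then have "Im (complex_of_real (falling_density \<Omega> w) / (z - complex_of_real w))
        = falling_density \<Omega> w * Im (1 / (z - complex_of_real w))"
      by (simp only: scaleR_complex.sel)
    also have "\<dots> = - (\<rho> w * P w)"
      unfolding z_def Im_inverse_sub_real by (simp add: \<rho>_def P_def)
    finally show "Im (indicator {-C..C} w *\<^sub>R (complex_of_real (falling_density \<Omega> w) / (z - complex_of_real w)))
        = - (indicator {-C..C} w *\<^sub>R (\<rho> w * P w))"
      by simp
  qed
  also have "\<dots> = - I"
    by (simp add: I_def set_lebesgue_integral_def)
  finally have ImJ: "Im (falling_potential \<Omega> C z) = - I" .
  \<comment> \<open>The ends are discarded because the derivative there is two-sided, while the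
    constant 1 - \<delta> is known only within [a, b].\<close>
  have ae: "AE w in lebesgue. w \<in> {a..b} \<longrightarrow> \<delta> / 2 \<le> \<rho> w \<and> \<rho> w \<le> 1 - \<delta> / 2"
    using AE_continual_diagram[OF \<Omega>] AE_lebesgue_neq[of a] AE_lebesgue_neq[of b]
  proof eventually_elim
    case (elim w)
    show ?case
    proof
      assume "w \<in> {a..b}"
      with elim have "a < w" "w < b" by auto
      then have "\<bar>deriv \<Omega> w\<bar> \<le> 1 - \<delta>"
        using elim by (intro deriv_bound_of_lipschitz[of a b \<Omega>, OF lip]) auto
      then show "\<delta> / 2 \<le> \<rho> w \<and> \<rho> w \<le> 1 - \<delta> / 2"
        using elim unfolding \<rho>_def by (auto simp: abs_le_iff field_simps)
    qed
  qed
  define \<theta>' where "\<theta>' = \<delta> / 2 * (LINT w:{a..b}|lebesgue. P w)"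
  have \<theta>'_eq: "\<theta>' = \<delta> / 2 * (arctan ((b - s) / v) - arctan ((a - s) / v))"
    unfolding \<theta>'_def using pk(1) abC by simp
  have iP': "integrable lebesgue (\<lambda>w. \<delta> / 2 * (indicator {a..b} w *\<^sub>R P w))"
    using iP(2) unfolding set_integrable_def by (intro integrable_mult_right)
  have \<theta>'_int: "\<theta>' = (\<integral>w. \<delta> / 2 * (indicator {a..b} w *\<^sub>R P w) \<partial>lebesgue)"
    unfolding \<theta>'_def set_lebesgue_integral_def by simp
  have I_lo: "\<theta>' \<le> I"
    unfolding I_def \<theta>'_int set_lebesgue_integral_def
  proof (rule integral_mono_AE[OF iP' i\<rho>[unfolded set_integrable_def]])
    show "AE w in lebesgue. \<delta> / 2 * (indicator {a..b} w *\<^sub>R P w) \<le> indicator {-C..C} w *\<^sub>R (\<rho> w * P w)"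
      using ae
    proof eventually_elim
      case (elim w)
      show ?case
      proof (cases "w \<in> {a..b}")
        case True
        have "\<delta> / 2 * P w \<le> \<rho> w * P w"
          using True elim P0[of w] by (intro mult_right_mono) auto
        moreover have "w \<in> {-C..C}"
          using True abC by auto
        ultimately show ?thesis
          using True by simp
      next
        case False
        then show ?thesis
          using P0[of w] falling_density_bounds(1)[of \<Omega> w] by (auto simp: \<rho>_def indicator_def)
      qed
    qed
  qed
  have I_hi: "I \<le> (LINT w:{-C..C}|lebesgue. P w) - \<theta>'"
  proof -
    have "I \<le> (\<integral>w. indicator {-C..C} w *\<^sub>R P w - \<delta> / 2 * (indicator {a..b} w *\<^sub>R P w) \<partial>lebesgue)"
      unfolding I_def set_lebesgue_integral_def
    proof (rule integral_mono_AE[OF i\<rho>[unfolded set_integrable_def]])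
      show "integrable lebesgue (\<lambda>w. indicator {-C..C} w *\<^sub>R P w - \<delta> / 2 * (indicator {a..b} w *\<^sub>R P w))"
        using iP(1) iP' unfolding set_integrable_def by (rule Bochner_Integration.integrable_diff)
      show "AE w in lebesgue. indicator {-C..C} w *\<^sub>R (\<rho> w * P w)
          \<le> indicator {-C..C} w *\<^sub>R P w - \<delta> / 2 * (indicator {a..b} w *\<^sub>R P w)"
        using ae
      proof eventually_elim
        case (elim w)
        show ?case
        proof (cases "w \<in> {a..b}")
          case True
          have "\<rho> w * P w \<le> (1 - \<delta> / 2) * P w"
            using True elim P0[of w] by (intro mult_right_mono) auto
          moreover have "w \<in> {-C..C}"
            using True abC by auto
          ultimately show ?thesis
            using True by (simp add: algebra_simps)
        next
          case False
          have "\<rho> w * P w \<le> 1 * P w"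
            unfolding \<rho>_def using P0[of w] falling_density_bounds(2)[of \<Omega> w] by (intro mult_right_mono)
          with False show ?thesis
            by (auto simp: indicator_def)
        qed
      qed
    qed
    also have "\<dots> = (LINT w:{-C..C}|lebesgue. P w) - \<theta>'"
      unfolding \<theta>'_int set_lebesgue_integral_def
      using iP(1) iP' unfolding set_integrable_def by (rule Bochner_Integration.integral_diff)
    finally show ?thesis .
  qed
  \<comment> \<open>Both ends of [a, b] are at distance at least c \<ge> c v from \<open>s\<close>,
    so each side carries Poisson mass at least arctan c.\<close>
  have \<theta>_le: "\<theta> \<le> \<theta>'"
  proof -
    have "c \<le> (b - s) / v" "c \<le> (s - a) / v"
    proof -
      have "c * v \<le> c * 1"
        using c v by (intro mult_left_mono) auto
      then have "c * v \<le> b - s" "c * v \<le> s - a"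
        using c by linarith+
      then show "c \<le> (b - s) / v" "c \<le> (s - a) / v"
        using v by (simp_all add: le_divide_eq)
    qed
    then have "arctan c \<le> arctan ((b - s) / v)" "arctan c \<le> arctan ((s - a) / v)"
      by (simp_all only: arctan_le_iff)
    moreover have "arctan ((a - s) / v) = - arctan ((s - a) / v)"
      by (metis arctan_minus minus_diff_eq minus_divide_left)
    ultimately have "2 * arctan c \<le> arctan ((b - s) / v) - arctan ((a - s) / v)"
      by linarith
    then have "\<delta> / 2 * (2 * arctan c) \<le> \<theta>'"
      unfolding \<theta>'_eq using \<delta> by (intro mult_left_mono) auto
    then show ?thesis
      by (simp add: \<theta>_def)
  qed
  show \<theta>0: "0 < \<delta> * arctan c"
    using \<delta> c by simp
  \<comment> \<open>The argument of z + C in (0, pi). Its arctan ((s + C) / v) cancels the one in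
    the Poisson mass of [-C, C], which leaves an upper bound on \<phi> independent of
    \<open>C\<close>.\<close>
  define \<beta> where "\<beta> = pi / 2 - arctan ((s + C) / v)"
  define \<phi> where "\<phi> = I + \<beta>"
  have tot: "(LINT w:{-C..C}|lebesgue. P w) = arctan ((C - s) / v) + arctan ((s + C) / v)"
  proof -
    have "arctan ((- C - s) / v) = - arctan ((s + C) / v)"
      by (metis add.commute arctan_minus minus_add_distrib minus_divide_left uminus_add_conv_diff diff_conv_add_uminus)
    then show ?thesis
      using pk(1)[of "- C" C] C by simp
  qed
  have \<phi>: "\<theta> \<le> \<phi>" "\<phi> \<le> pi - \<theta>"
    using I_lo I_hi \<theta>_le arctan_ubound[of "(s + C) / v"] arctan_ubound[of "(C - s) / v"]
    unfolding \<phi>_def \<beta>_def tot by linarith+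
  \<comment> \<open>The two bounds on \<phi> together give 2 \<theta> \<le> pi.\<close>
  show "\<delta> * arctan c \<le> pi / 2"
    using \<phi> unfolding \<theta>_def by linarith
  define R where "R = norm (z + complex_of_real C)"
  have polar: "z + complex_of_real C = complex_of_real R * exp (\<i> * complex_of_real \<beta>)"
  proof -
    have "0 < Im (z + complex_of_real C)"
      using z by simp
    then have "Arg2pi (z + complex_of_real C) = \<beta>"
      by (subst Arg2pi_arctan_upperhalf) (simp_all add: \<beta>_def z_def)
    then show ?thesis
      using Arg2pi_eq[of "z + complex_of_real C"] by (simp add: R_def)
  qed
  have R: "0 < R"
    using sub_real_nonzero[OF z(1), of "- C"] by (simp add: R_def)
  define E where "E = exp (Re (falling_potential \<Omega> C z))"
  have "cauchy_transform (transition_measure \<Omega>) z = exp (falling_potential \<Omega> C z) / (z + complex_of_real C)"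
    by (rule cauchy_transform_transition_measure[OF \<Omega> z(1) C])
  also have "\<dots> = complex_of_real (E / R) * exp (\<i> * complex_of_real (- \<phi>))"
  proof -
    have "falling_potential \<Omega> C z = complex_of_real (Re (falling_potential \<Omega> C z)) + \<i> * complex_of_real (- I)"
      by (simp add: complex_eq_iff ImJ)
    then have "exp (falling_potential \<Omega> C z) = complex_of_real E * exp (\<i> * complex_of_real (- I))"
      unfolding E_def by (metis exp_add exp_of_real)
    moreover have "exp (\<i> * complex_of_real (- \<phi>)) = exp (\<i> * complex_of_real (- I)) / exp (\<i> * complex_of_real \<beta>)"
      unfolding exp_diff[symmetric] \<phi>_def by (simp add: algebra_simps)
    ultimately show ?thesis
      unfolding polar by simp
  qed
  finally have G: "cauchy_transform (transition_measure \<Omega>) z = complex_of_real (E / R) * exp (\<i> * complex_of_real (- \<phi>))" .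
  have nG: "norm (cauchy_transform (transition_measure \<Omega>) z) = E / R"
    unfolding G norm_mult norm_exp_i_times norm_of_real using R by (simp add: E_def)
  have "Im (exp (\<i> * complex_of_real (- \<phi>))) = sin (- \<phi>)"
    by (simp only: cis_conv_exp[symmetric] cis.sel)
  then have "Im (cauchy_transform (transition_measure \<Omega>) z) = E / R * sin (- \<phi>)"
    unfolding G by (simp only: Im_complex_of_real Re_complex_of_real times_complex.sel)
  then have iG: "- Im (cauchy_transform (transition_measure \<Omega>) z) = E / R * sin \<phi>"
    by simp
  have "E / R * sin \<theta> \<le> E / R * sin \<phi>"
    using sin_ge_sin_of_mem[of \<theta> \<phi>] \<theta>0 \<phi> R by (intro mult_left_mono) (auto simp: \<theta>_def E_def)
  then show "norm (cauchy_transform (transition_measure \<Omega>) (Complex s v)) * sin (\<delta> * arctan c)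
      \<le> - Im (cauchy_transform (transition_measure \<Omega>) (Complex s v))"
    using nG iG unfolding z_def \<theta>_def by simp
qed

section \<open>Distance of cumulative functions\<close>

text \<open>On [a, b] the density is at most K and the Poisson kernel has mass at most pi; outside,
  |s - t| \<ge> c and v \<le> 1 bound the kernel by 1 / c^2.\<close>

lemma Im_cauchy_transform_le_density:
  fixes \<mu> :: "real measure"
  assumes \<mu>: "prob_space \<mu>" "sets \<mu> = sets borel"
    and f[measurable]: "f \<in> borel_measurable lborel" and f_bd: "\<forall>x\<in>{a..b}. 0 \<le> f x \<and> f x \<le> K"
    and dens: "\<forall>A\<in>sets borel. A \<subseteq> {a..b} \<longrightarrow> emeasure \<mu> A = (\<integral>\<^sup>+x\<in>A. ennreal (f x) \<partial>lborel)"
    and c: "0 < c" "a + c \<le> s" "s + c \<le> b" and v: "0 < v" "v \<le> 1"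
  shows "- Im (cauchy_transform \<mu> (Complex s v)) \<le> K * pi + 1 / c\<^sup>2"
proof -
  interpret prob_space \<mu> by (rule \<mu>)
  note \<mu>(2)[measurable_cong]
  define P where "P t = v / ((s - t)\<^sup>2 + v\<^sup>2)" for t
  have P[measurable]: "P \<in> borel_measurable borel"
    unfolding P_def by measurable
  have P0: "0 \<le> P t" for t
    using v by (simp add: P_def)
  have ab: "a \<le> b" using c by simp
  have K: "0 \<le> K"
    using f_bd ab by fastforce
  have P_le: "norm (P t) \<le> v / v\<^sup>2" for t
    unfolding P_def using v by (auto intro!: divide_left_mono mult_pos_pos add_nonneg_pos)
  have iP: "integrable \<mu> P"
    by (rule integrable_bounded_prob[OF \<mu> P P_le])
  \<comment> \<open>The hypothesis speaks of measures of subsets of [a, b]; an equality of measures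
    is what lets the Poisson kernel be integrated.\<close>
  have eq_dens: "density \<mu> (indicator {a..b}) = density lborel (\<lambda>x. ennreal (f x) * indicator {a..b} x)"
  proof (rule measure_eqI)
    fix A assume "A \<in> sets (density \<mu> (indicator {a..b}))"
    then have A[measurable]: "A \<in> sets borel"
      using \<mu>(2) by simp
    have "emeasure (density \<mu> (indicator {a..b})) A = (\<integral>\<^sup>+x. indicator {a..b} x * indicator A x \<partial>\<mu>)"
      by (rule emeasure_density) (use A \<mu>(2) in auto)
    also have "\<dots> = (\<integral>\<^sup>+x. indicator ({a..b} \<inter> A) x \<partial>\<mu>)"
      by (simp only: indicator_inter_arith)
    also have "\<dots> = emeasure \<mu> ({a..b} \<inter> A)"
      using A \<mu>(2) by (intro nn_integral_indicator) auto
    also have "\<dots> = (\<integral>\<^sup>+x\<in>{a..b} \<inter> A. ennreal (f x) \<partial>lborel)"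
      using dens A by auto
    also have "\<dots> = emeasure (density lborel (\<lambda>x. ennreal (f x) * indicator {a..b} x)) A"
      by (subst emeasure_density) (auto simp: indicator_inter_arith mult_ac intro!: nn_integral_cong)
    finally show "emeasure (density \<mu> (indicator {a..b})) A
        = emeasure (density lborel (\<lambda>x. ennreal (f x) * indicator {a..b} x)) A" .
  qed (use \<mu>(2) in simp)
  have "(\<integral>\<^sup>+t. indicator {a..b} t * ennreal (P t) \<partial>\<mu>) = (\<integral>\<^sup>+t. ennreal (P t) \<partial>density \<mu> (indicator {a..b}))"
    by (subst nn_integral_density) auto
  also have "\<dots> = (\<integral>\<^sup>+t. ennreal (f t) * indicator {a..b} t * ennreal (P t) \<partial>lborel)"
    unfolding eq_dens by (subst nn_integral_density) auto
  also have "\<dots> \<le> (\<integral>\<^sup>+t. ennreal (K * P t) * indicator {a..b} t \<partial>lborel)"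
  proof (rule nn_integral_mono)
    fix t :: real
    show "ennreal (f t) * indicator {a..b} t * ennreal (P t) \<le> ennreal (K * P t) * indicator {a..b} t"
      using f_bd P0[of t] by (auto simp: indicator_def ennreal_mult'[symmetric] intro!: ennreal_leI mult_right_mono)
  qed
  also have "\<dots> = ennreal (K * arctan ((b - s) / v) - K * arctan ((a - s) / v))"
  proof (rule nn_integral_FTC_Icc[OF _ _ _ ab])
    fix w :: real
    have "((\<lambda>w. K * arctan ((w - s) / v)) has_real_derivative K * (inverse (1 + ((w - s) / v)\<^sup>2) * (1 / v))) (at w)"
      using v by (auto intro!: derivative_eq_intros)
    moreover have "inverse (1 + ((w - s) / v)\<^sup>2) * (1 / v) = P w"
    proof -
      have "1 + ((w - s) / v)\<^sup>2 = ((s - w)\<^sup>2 + v\<^sup>2) / v\<^sup>2"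
        using v by (simp add: power_divide power2_commute field_simps)
      then show ?thesis
        using v by (simp add: P_def power2_eq_square)
    qed
    ultimately show "((\<lambda>w. K * arctan ((w - s) / v)) has_real_derivative K * P w) (at w)"
      by (simp only:)
    show "0 \<le> K * P w"
      using K P0 by simp
  qed auto
  also have "\<dots> \<le> ennreal (K * pi)"
  proof (rule ennreal_leI)
    have "arctan ((b - s) / v) - arctan ((a - s) / v) \<le> pi"
      using arctan_ubound[of "(b - s) / v"] arctan_lbound[of "(a - s) / v"] by linarith
    then show "K * arctan ((b - s) / v) - K * arctan ((a - s) / v) \<le> K * pi"
      unfolding right_diff_distrib[symmetric] using K by (intro mult_left_mono)
  qed
  finally have inner: "(\<integral>\<^sup>+t. indicator {a..b} t * ennreal (P t) \<partial>\<mu>) \<le> ennreal (K * pi)" .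
  have outer: "P t \<le> 1 / c\<^sup>2" if "t \<notin> {a..b}" for t
  proof -
    have "c \<le> \<bar>s - t\<bar>"
      using that c by auto
    then have "c\<^sup>2 \<le> (s - t)\<^sup>2"
      using c(1) by (metis abs_of_pos power2_abs power_mono less_imp_le)
    then have "v / ((s - t)\<^sup>2 + v\<^sup>2) \<le> 1 / c\<^sup>2"
      using c v by (intro frac_le) (auto simp: add_increasing2)
    then show ?thesis
      by (simp add: P_def)
  qed
  have "ennreal (- Im (cauchy_transform \<mu> (Complex s v))) = (\<integral>\<^sup>+t. ennreal (P t) \<partial>\<mu>)"
    unfolding Im_cauchy_transform[OF \<mu> v(1)] minus_minus P_def[symmetric]
    using iP P0 by (intro nn_integral_eq_integral[symmetric]) auto
  also have "\<dots> \<le> (\<integral>\<^sup>+t. indicator {a..b} t * ennreal (P t) + ennreal (1 / c\<^sup>2) \<partial>\<mu>)"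
    using outer by (intro nn_integral_mono) (auto simp: indicator_def intro!: ennreal_leI)
  also have "\<dots> = (\<integral>\<^sup>+t. indicator {a..b} t * ennreal (P t) \<partial>\<mu>) + ennreal (1 / c\<^sup>2)"
    by (subst nn_integral_add) (auto simp: emeasure_space_1)
  also have "\<dots> \<le> ennreal (K * pi) + ennreal (1 / c\<^sup>2)"
    using inner by (rule add_right_mono)
  also have "\<dots> = ennreal (K * pi + 1 / c\<^sup>2)"
    using K c by (intro ennreal_plus[symmetric]) auto
  finally show ?thesis
    using K c by (subst (asm) ennreal_le_iff) auto
qed

text \<open>The constant is fixed before the diagram, the scale and the point, so the bound can be
  applied sample by sample. The decay 1 / (1 + v) joins the local estimate for v \<le> 1 to |G|
  \<le> 1 / v for v > 1.\<close>

theorem cumulative_diff_bound: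
  assumes \<Omega>: "continual_diagram \<Omega>" and ord: "a < a0" "b0 < b"
    and lip: "\<exists>\<delta>>0. \<forall>x\<in>{a..b}. \<forall>y\<in>{a..b}. \<bar>\<Omega> x - \<Omega> y\<bar> \<le> (1 - \<delta>) * \<bar>x - y\<bar>"
    and dens: "\<exists>f C. f \<in> borel_measurable lborel \<and> (\<forall>x\<in>{a..b}. 0 \<le> f x \<and> f x \<le> C) \<and>
           (\<forall>A\<in>sets borel. A \<subseteq> {a..b} \<longrightarrow>
              emeasure (transition_measure \<Omega>) A = (\<integral>\<^sup>+x\<in>A. ennreal (f x) \<partial>lborel))"
  obtains M where "0 \<le> M"
    "\<forall>\<omega> e s. continual_diagram \<omega> \<longrightarrow> 0 < e \<longrightarrow> (\<forall>w. \<bar>\<Omega> w - \<omega> w\<bar> \<le> 2 * e) \<longrightarrow> s \<in> {a0..b0} \<longrightarrow>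
      \<bar>cumulative \<omega> s - cumulative \<Omega> s\<bar> \<le> M * (e * ln (1 + 1 / e))"
proof -
  obtain \<delta> where \<delta>: "0 < \<delta>"
    "\<And>x y. x \<in> {a..b} \<Longrightarrow> y \<in> {a..b} \<Longrightarrow> \<bar>\<Omega> x - \<Omega> y\<bar> \<le> (1 - \<delta>) * \<bar>x - y\<bar>"
    using lip by blast
  obtain f K where f: "f \<in> borel_measurable lborel" "\<forall>x\<in>{a..b}. 0 \<le> f x \<and> f x \<le> K"
    "\<forall>A\<in>sets borel. A \<subseteq> {a..b} \<longrightarrow> emeasure (transition_measure \<Omega>) A = (\<integral>\<^sup>+x\<in>A. ennreal (f x) \<partial>lborel)"
    using dens by blast
  define c where "c = min (a0 - a) (b - b0)"
  \<comment> \<open>The quotient divides the bound on - Im G by the sine of the guaranteed angle;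
    the entry 1 lets the same \<open>B\<close> serve v > 1, where 1 / v \<le> 2 / (1 + v).\<close>
  define B where "B = max 1 ((K * pi + 1 / c\<^sup>2) / sin (\<delta> * arctan c))"
  note p\<Omega> = transition_measure_prob[OF \<Omega>]
  have G\<Omega>: "norm (cauchy_transform (transition_measure \<Omega>) (Complex s v)) \<le> 2 * B / (1 + v)"
    if s: "s \<in> {a0..b0}" and v: "0 < v" for s v
  proof (cases "v \<le> 1")
    case True
    have c: "0 < c" "a + c \<le> s" "s + c \<le> b"
      using ord s by (auto simp: c_def)
    note G = norm_cauchy_transform_le_Im[OF \<Omega> \<delta>(2,1) c v True]
    have "0 < sin (\<delta> * arctan c)"
      using G(2,3) by (intro sin_gt_zero) (auto intro: le_less_trans[OF _ pi_half_less_two[THEN less_le_trans]])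
    moreover have "norm (cauchy_transform (transition_measure \<Omega>) (Complex s v)) * sin (\<delta> * arctan c) \<le> K * pi + 1 / c\<^sup>2"
      using G(1) Im_cauchy_transform_le_density[OF p\<Omega> f c v True] by linarith
    ultimately have "norm (cauchy_transform (transition_measure \<Omega>) (Complex s v)) \<le> B"
      unfolding B_def by (simp add: le_divide_eq le_max_iff_disj)
    also have "B \<le> 2 * B / (1 + v)"
    proof -
      have "B * (1 + v) \<le> B * 2"
        using True by (intro mult_left_mono) (auto simp: B_def)
      then show ?thesis
        using v by (simp add: le_divide_eq mult.commute)
    qed
    finally show ?thesis .
  next
    case False
    have "norm (cauchy_transform (transition_measure \<Omega>) (Complex s v)) \<le> 1 / v"
      using norm_cauchy_transform_le[OF p\<Omega>, of "Complex s v"] v by simp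
    also have "\<dots> \<le> 2 / (1 + v)"
      using False by (simp add: field_simps)
    also have "\<dots> \<le> 2 * B / (1 + v)"
      using v by (intro divide_right_mono) (auto simp: B_def)
    finally show ?thesis .
  qed
  have B0: "0 \<le> B" by (simp add: B_def)
  define M where "M = 2 * B * exp pi"
  have M0: "0 \<le> M" using B0 by (simp add: M_def)
  have "\<forall>\<omega> e s. continual_diagram \<omega> \<longrightarrow> 0 < e \<longrightarrow> (\<forall>w. \<bar>\<Omega> w - \<omega> w\<bar> \<le> 2 * e) \<longrightarrow> s \<in> {a0..b0} \<longrightarrow>
      \<bar>cumulative \<omega> s - cumulative \<Omega> s\<bar> \<le> (M * pi + 2 * M) * (e * ln (1 + 1 / e))"
  proof (intro allI impI)
    fix \<omega> :: "real \<Rightarrow> real" and e s :: real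
    assume \<omega>: "continual_diagram \<omega>" and e: "0 < e" and close: "\<forall>w. \<bar>\<Omega> w - \<omega> w\<bar> \<le> 2 * e"
      and s: "s \<in> {a0..b0}"
    have key: "norm (cauchy_transform (transition_measure \<omega>) (Complex s v)) \<le> M / (1 + v) \<and>
        norm (cauchy_transform (transition_measure \<omega>) (Complex s v) - cauchy_transform (transition_measure \<Omega>) (Complex s v))
          \<le> M * pi * e / (v * (1 + v))" if ev: "e \<le> v" for v
    proof -
      have v: "0 < v" using e ev by simp
      obtain \<Delta> where \<Delta>: "norm \<Delta> \<le> pi * e / v"
        and G\<omega>: "cauchy_transform (transition_measure \<omega>) (Complex s v)
          = cauchy_transform (transition_measure \<Omega>) (Complex s v) * exp \<Delta>"
        using cauchy_transform_ratio[OF \<Omega> \<omega> close[rule_format] v] by blast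
      have "pi * e / v \<le> pi"
        using v ev by (simp add: divide_le_eq)
      then have \<Delta>_pi: "norm \<Delta> \<le> pi"
        using \<Delta> by simp
      have "norm (exp \<Delta>) \<le> exp pi"
        using order_trans[OF norm_exp, of \<Delta> "exp pi"] \<Delta>_pi by simp
      then have 1: "norm (cauchy_transform (transition_measure \<omega>) (Complex s v)) \<le> 2 * B / (1 + v) * exp pi"
        unfolding G\<omega> norm_mult using G\<Omega>[OF s v] B0 v by (intro mult_mono) auto
      \<comment> \<open>The order-zero remainder keeps the factor e / v, whose 1 / v joins 1 / (1 +
        v) in the logarithmic integral.\<close>
      have "norm (exp \<Delta> - 1) \<le> exp \<bar>Re \<Delta>\<bar> * norm \<Delta>"
        using Taylor_exp[of \<Delta> 0] by simp
      also have "\<dots> \<le> exp pi * (pi * e / v)"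
        using \<Delta> \<Delta>_pi order_trans[OF abs_Re_le_cmod \<Delta>_pi] by (intro mult_mono) auto
      finally have ex: "norm (exp \<Delta> - 1) \<le> exp pi * (pi * e / v)" .
      have "cauchy_transform (transition_measure \<omega>) (Complex s v) - cauchy_transform (transition_measure \<Omega>) (Complex s v)
          = cauchy_transform (transition_measure \<Omega>) (Complex s v) * (exp \<Delta> - 1)"
        unfolding G\<omega> by (simp add: right_diff_distrib)
      also have "norm \<dots> \<le> 2 * B / (1 + v) * (exp pi * (pi * e / v))"
        unfolding norm_mult using G\<Omega>[OF s v] ex B0 v by (intro mult_mono) auto
      finally show ?thesis
        using 1 by (simp add: M_def mult_ac)
    qed
    have key\<Omega>: "norm (cauchy_transform (transition_measure \<Omega>) (Complex s v)) \<le> M / (1 + v)" if ev: "e \<le> v" for v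
    proof -
      have v: "0 < v" using e ev by simp
      have "2 * B * 1 \<le> 2 * B * exp pi"
        using B0 by (intro mult_left_mono) auto
      then have "2 * B / (1 + v) \<le> M / (1 + v)"
        unfolding M_def using v by (intro divide_right_mono) auto
      then show ?thesis
        using G\<Omega>[OF s v] by linarith
    qed
    show "\<bar>cumulative \<omega> s - cumulative \<Omega> s\<bar> \<le> (M * pi + 2 * M) * (e * ln (1 + 1 / e))"
      unfolding cumulative_def
      by (rule cdf_diff_le_cauchy_transform_diff[OF transition_measure_prob[OF \<omega>] p\<Omega> e M0])
        (use key key\<Omega> M0 in auto)
  qed
  then show thesis
    using M0 by (intro that[of "M * pi + 2 * M"]) auto
qed

text \<open>The point (x, y) with x - y = z and x + y = \<Omega>(z) lies on \<Omega>, and the slice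
  of \<omega> at x contains some y' near y. Then \<omega>(x - y') = x + y' differs from \<Omega>(z)
  by |y - y'|, and moving the argument back to z costs |y - y'| again, whence the factor 2.\<close>

lemma diag_dist_imp_sup_bound:
  assumes \<Omega>: "continual_diagram \<Omega>" and \<omega>: "continual_diagram \<omega>"
    and d: "diag_dist \<Omega> \<omega> \<le> ennreal e" and e: "0 \<le> e"
  shows "\<bar>\<Omega> z - \<omega> z\<bar> \<le> 2 * e"
proof (rule field_le_epsilon)
  fix \<epsilon> :: real assume \<epsilon>: "0 < \<epsilon>"
  define x where "x = (\<Omega> z + z) / 2"
  define y where "y = (\<Omega> z - z) / 2"
  have xy: "0 \<le> x" "0 \<le> y" "x - y = z" "x + y = \<Omega> z"
    using continual_diagram_ge_abs[OF \<Omega>, of z] by (auto simp: x_def y_def field_simps abs_le_iff)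
  have "(INF b\<in>PiY \<omega> x. ennreal \<bar>y - b\<bar>) \<le> (SUP a\<in>PiY \<Omega> x. INF b\<in>PiY \<omega> x. ennreal \<bar>a - b\<bar>)"
    using xy by (intro SUP_upper) (simp add: PiY_def)
  also have "\<dots> \<le> hausdorff_dist (PiY \<Omega> x) (PiY \<omega> x)"
    unfolding hausdorff_dist_def by simp
  also have "\<dots> \<le> dY \<Omega> \<omega>"
    unfolding dY_def using xy by (intro SUP_upper) simp
  also have "\<dots> \<le> diag_dist \<Omega> \<omega>"
    unfolding diag_dist_def by simp
  also note d
  \<comment> \<open>Slack for the infimum over the slice, which is not shown to be attained.\<close>
  also have "ennreal e < ennreal (e + \<epsilon> / 2)"
    using e \<epsilon> by (simp add: ennreal_less_iff)
  finally obtain y' where y': "y' \<in> PiY \<omega> x" "ennreal \<bar>y - y'\<bar> < ennreal (e + \<epsilon> / 2)"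
    unfolding INF_less_iff by blast
  then have close: "\<bar>y - y'\<bar> < e + \<epsilon> / 2" and \<omega>y': "\<omega> (x - y') = x + y'"
    by (auto simp: ennreal_less_iff PiY_def)
  have "\<bar>\<omega> (x - y') - \<omega> (x - y)\<bar> \<le> 1 * \<bar>(x - y') - (x - y)\<bar>"
    by (rule continual_diagram_lipschitz[OF \<omega>])
  then show "\<bar>\<Omega> z - \<omega> z\<bar> \<le> 2 * e + \<epsilon>"
    unfolding xy(3) \<omega>y' mult_1 using close xy(3,4) by linarith
qed

section \<open>Passage to convergence in probability\<close>

lemma outer_prob_nonneg: "S \<subseteq> space M \<Longrightarrow> 0 \<le> outer_prob M S"
  unfolding outer_prob_def by (intro cINF_greatest) auto

lemma outer_prob_mono:
  assumes "S \<subseteq> T" "T \<subseteq> space M"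
  shows "outer_prob M S \<le> outer_prob M T"
  unfolding outer_prob_def using assms
  by (intro cInf_superset_mono image_mono) (auto intro!: bdd_belowI2[of _ 0])

text \<open>For e = \<eta> / (n^\<alpha> ln n) one has n^\<alpha> e = \<eta> / ln n, while ln (1 + 1
  / e) grows like \<alpha> ln n.\<close>

lemma scaled_error_tendsto:
  fixes \<alpha> \<eta> M :: real
  assumes "0 < \<alpha>" "0 < \<eta>"
  shows "(\<lambda>n. real n powr \<alpha> * (M * ((\<eta> / (real n powr \<alpha> * ln (real n)))
      * ln (1 + 1 / (\<eta> / (real n powr \<alpha> * ln (real n))))))) \<longlonglongrightarrow> M * \<eta> * \<alpha>"
  using assms by real_asymp

text \<open>The estimate is deterministic, so for large n the bad event for the cumulative functions
  is contained in the one for the metric; monotonicity of the outer probability then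
  concludes.\<close>

theorem mainTheorem2:
  fixes \<alpha> :: real and \<Omega> :: "real \<Rightarrow> real" and a a0 b0 b :: real
    and M :: "'s measure" and \<omega> :: "nat \<Rightarrow> 's \<Rightarrow> real \<Rightarrow> real"
  assumes "\<alpha> > 0"
    and "continual_diagram \<Omega>"
    and "a < a0" "a0 < b0" "b0 < b"
    and "\<exists>\<delta>>0. \<forall>x\<in>{a..b}. \<forall>y\<in>{a..b}. \<bar>\<Omega> x - \<Omega> y\<bar> \<le> (1 - \<delta>) * \<bar>x - y\<bar>"
    and "\<exists>f C. f \<in> borel_measurable lborel \<and> (\<forall>x\<in>{a..b}. 0 \<le> f x \<and> f x \<le> C) \<and>
           (\<forall>A\<in>sets borel. A \<subseteq> {a..b} \<longrightarrow>
              emeasure (transition_measure \<Omega>) A = (\<integral>\<^sup>+x\<in>A. ennreal (f x) \<partial>lborel))"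
    and "prob_space M"
    and "\<forall>n. \<forall>s\<in>space M. continual_diagram (\<omega> n s)"
    and "conv_prob_zero M (\<lambda>n s. ennreal (real n powr \<alpha> * ln (real n)) * diag_dist \<Omega> (\<omega> n s))"
  shows "conv_prob_zero M (\<lambda>n s. real n powr \<alpha> *
            (SUP z\<in>{a0..b0}. \<bar>cumulative (\<omega> n s) z - cumulative \<Omega> z\<bar>))"
  unfolding conv_prob_zero_def
proof (intro allI impI)
  fix \<epsilon> :: real assume \<epsilon>: "0 < \<epsilon>"
  obtain B where B: "0 \<le> B"
    "\<forall>\<omega> e s. continual_diagram \<omega> \<longrightarrow> 0 < e \<longrightarrow> (\<forall>w. \<bar>\<Omega> w - \<omega> w\<bar> \<le> 2 * e) \<longrightarrow> s \<in> {a0..b0} \<longrightarrow>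
      \<bar>cumulative \<omega> s - cumulative \<Omega> s\<bar> \<le> B * (e * ln (1 + 1 / e))"
    using cumulative_diff_bound[OF assms(2,3,5,6,7)] by blast
  \<comment> \<open>Makes the limit of the scaled error \<epsilon> B / (2 (B + 1)), which is below
    \<epsilon>; B + 1 guards against B = 0.\<close>
  define \<eta> where "\<eta> = \<epsilon> / (2 * (B + 1) * \<alpha>)"
  have \<eta>: "0 < \<eta>"
    using \<epsilon> B(1) assms(1) by (simp add: \<eta>_def)
  have "B * \<eta> * \<alpha> < \<epsilon>"
  proof -
    have "B * \<eta> * \<alpha> = \<epsilon> * (B / (2 * (B + 1)))"
      using assms(1) by (simp add: \<eta>_def)
    also have "\<dots> < \<epsilon> * 1"
      using \<epsilon> B(1) by (intro mult_strict_left_mono) (auto simp: divide_less_eq)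
    finally show ?thesis by simp
  qed
  define e where "e n = \<eta> / (real n powr \<alpha> * ln (real n))" for n :: nat
  have "\<forall>\<^sub>F n in sequentially. real n powr \<alpha> * (B * (e n * ln (1 + 1 / e n))) < \<epsilon>"
    using order_tendstoD(2)[OF scaled_error_tendsto[OF assms(1) \<eta>, of B] \<open>B * \<eta> * \<alpha> < \<epsilon>\<close>]
    unfolding e_def .
  \<comment> \<open>For n = 0 and n = 1 the scaling factor vanishes and could not be divided
    out.\<close>
  moreover have "\<forall>\<^sub>F n in sequentially. 2 \<le> (n::nat)"
    by (rule eventually_ge_at_top)
  ultimately have incl: "\<forall>\<^sub>F n in sequentially.
      {s \<in> space M. \<epsilon> < real n powr \<alpha> * (SUP z\<in>{a0..b0}. \<bar>cumulative (\<omega> n s) z - cumulative \<Omega> z\<bar>)}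
      \<subseteq> {s \<in> space M. ennreal \<eta> < ennreal (real n powr \<alpha> * ln (real n)) * diag_dist \<Omega> (\<omega> n s)}"
  proof eventually_elim
    case (elim n)
    have pos: "0 < real n powr \<alpha> * ln (real n)"
      using elim(2) by simp
    have e: "0 < e n"
      using pos \<eta> by (simp add: e_def)
    have "real n powr \<alpha> * (SUP z\<in>{a0..b0}. \<bar>cumulative (\<omega> n s) z - cumulative \<Omega> z\<bar>) \<le> \<epsilon>"
      if s: "s \<in> space M" and le: "ennreal (real n powr \<alpha> * ln (real n)) * diag_dist \<Omega> (\<omega> n s) \<le> ennreal \<eta>" for s
    proof -
      have \<omega>: "continual_diagram (\<omega> n s)"
        using assms(9) s by blast
      \<comment> \<open>Multiplying by the reciprocal cancels the factor even if \<open>d\<close> is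
        infinite.\<close>
      have "ennreal (1 / r) * (ennreal r * d) = d" if "0 < r" for r and d :: ennreal
        using that by (simp add: mult.assoc[symmetric] ennreal_mult'[symmetric])
      from this[OF pos] have "diag_dist \<Omega> (\<omega> n s)
          = ennreal (1 / (real n powr \<alpha> * ln (real n))) * (ennreal (real n powr \<alpha> * ln (real n)) * diag_dist \<Omega> (\<omega> n s))"
        by (rule sym)
      also have "\<dots> \<le> ennreal (1 / (real n powr \<alpha> * ln (real n))) * ennreal \<eta>"
        using le by (intro mult_left_mono) auto
      also have "\<dots> = ennreal (e n)"
        using \<eta> by (simp add: e_def ennreal_mult''[symmetric])
      finally have d: "diag_dist \<Omega> (\<omega> n s) \<le> ennreal (e n)" .
      have "(SUP z\<in>{a0..b0}. \<bar>cumulative (\<omega> n s) z - cumulative \<Omega> z\<bar>) \<le> B * (e n * ln (1 + 1 / e n))"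
        using assms(4) diag_dist_imp_sup_bound[OF assms(2) \<omega> d] e
        by (intro cSUP_least B(2)[rule_format, OF \<omega>]) auto
      then have "real n powr \<alpha> * (SUP z\<in>{a0..b0}. \<bar>cumulative (\<omega> n s) z - cumulative \<Omega> z\<bar>)
          \<le> real n powr \<alpha> * (B * (e n * ln (1 + 1 / e n)))"
        by (intro mult_left_mono) auto
      then show ?thesis
        using elim(1) by linarith
    qed
    then show ?case
      by (auto simp: not_le[symmetric])
  qed
  show "(\<lambda>n. outer_prob M {s \<in> space M. \<epsilon> < real n powr \<alpha> * (SUP z\<in>{a0..b0}. \<bar>cumulative (\<omega> n s) z - cumulative \<Omega> z\<bar>)})
      \<longlonglongrightarrow> 0"
  proof (rule tendsto_sandwich[OF _ _ tendsto_const])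
    show "(\<lambda>n. outer_prob M {s \<in> space M. ennreal \<eta> < ennreal (real n powr \<alpha> * ln (real n)) * diag_dist \<Omega> (\<omega> n s)})
        \<longlonglongrightarrow> 0"
      using assms(10) \<eta> unfolding conv_prob_zero_def by (simp add: ennreal_less_iff)
    show "\<forall>\<^sub>F n in sequentially. 0 \<le> outer_prob M
        {s \<in> space M. \<epsilon> < real n powr \<alpha> * (SUP z\<in>{a0..b0}. \<bar>cumulative (\<omega> n s) z - cumulative \<Omega> z\<bar>)}"
      by (intro always_eventually allI outer_prob_nonneg) auto
    show "\<forall>\<^sub>F n in sequentially. outer_prob M
        {s \<in> space M. \<epsilon> < real n powr \<alpha> * (SUP z\<in>{a0..b0}. \<bar>cumulative (\<omega> n s) z - cumulative \<Omega> z\<bar>)}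
      \<le> outer_prob M {s \<in> space M. ennreal \<eta> < ennreal (real n powr \<alpha> * ln (real n)) * diag_dist \<Omega> (\<omega> n s)}"
      using incl by eventually_elim (rule outer_prob_mono, auto)
  qed
qed

end
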